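(* Let $F$ be $\rho$-smooth on $\mathbb{R}^n$, i.e. $\|\nabla F(x)-\nabla F(y)\|\le\rho\|x-y\|$ for all $x,y$. Assume $\mathbb{E}_{\xi_k}[g^{(k)}]=\nabla F(x^{(k-\tau_k)})$ for each $k$; that there is $\sigma\ge0$ with $\mathbb{E}_\xi\|\nabla f(x;\xi)-\nabla F(x)\|^2\le\sigma^2$ for all $x$; and that there is a finite integer $\tau$ with $\tau_k\le\tau$ for all $k\ge1$. Given a maximum number $K$ of iterations, let $\alpha_k=\alpha/\sqrt K$ for all $k=1,\ldots,K$ and for some $\alpha>0$. If $\alpha>0$ and $\beta\in(0,1)$ are chosen such that $$\tau^2+\frac{\tau}{1-\beta}+\frac{\beta^2}{1-\beta^2}\le\frac{(1-\beta)^2K}{2\alpha^2\rho^2}\quad\text{and}\quad 3\rho+\frac{2(1+5\rho)\beta^2}{(1-\beta)(1-\beta^2)}\le\frac{(1-\beta)\sqrt K}{2\alpha},$$ then, with $\bar x^{(K)}$ drawn from $\{x^{(k)}\}_{k=1}^K$ with $\mathrm{Prob}(\bar x^{(K)}=x^{(k)})=\alpha_k/\sum_{j=1}^K\alpha_j$, where $\{x^{(k)}\}$ is generated by the algorithm in the context, $$\mathbb{E}\|\nabla F(\bar x^{(K)})\|^2\le\left(\frac{\rho^2\alpha\tau}{2(1-\beta)\sqrt K}+\frac{(1+5\rho)\beta^2}{2(1-\beta^2)}+\rho\right)\frac{4\alpha\sigma^2}{(1-\beta)\sqrt K}+\frac{4(1-\beta)\left[F(x^{(1)})-\inf_xF(x)\right]}{\alpha\sqrt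 K}.$$
   Context: Problem: minimize $F(x)=\mathbb{E}_\xi[f(x;\xi)]$ over $x\in\mathbb{R}^n$, where $\xi$ is a random variable and $F$ is smooth and possibly nonconvex. $\|\cdot\|$ is the Euclidean norm. Algorithm: choose $x^{(0)}\in\mathbb{R}^n$, set $x^{(1)}=x^{(0)}$, and fix $\beta\in(0,1)$; convention $\alpha_0=\alpha_1$. For $k=1,2,\ldots$: let $g^{(k)}=\nabla f(x^{(k-\tau_k)};\xi_k)$, where $\xi_k$ is a fresh sample of $\xi$ and the nonnegative integer $\tau_k$ is a delay (with the convention $x^{(j)}=x^{(1)}$ for $j\le0$), and set $$x^{(k+1)}=x^{(k)}-\alpha_kg^{(k)}+\beta_k(x^{(k)}-x^{(k-1)}),\qquad\beta_k=\frac{\alpha_k}{\alpha_{k-1}}\beta.$$ Equivalently, $m^{(0)}=0$, $m^{(k)}=\beta m^{(k-1)}+(1-\beta)g^{(k)}$, $x^{(k+1)}=x^{(k)}-\frac{\alpha_k}{1-\beta}m^{(k)}$. $\mathbb{E}_{\xi_k}$ is expectation with respect to $\xi_k$ conditionally on the past; $\mathbb{E}$ is total expectation. *)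

theory Defs
  imports "HOL-Probability.Probability"
begin

text \<open>Only meaningful where \<open>h\<close> is differentiable.\<close>

definition grad :: "(real ^ 'n \<Rightarrow> real) \<Rightarrow> real ^ 'n \<Rightarrow> real ^ 'n" where
  "grad h x = (THE D. GDERIV h x :> D)"

definition smooth_with :: "real \<Rightarrow> (real ^ 'n \<Rightarrow> real) \<Rightarrow> bool" where
  "smooth_with \<rho> h \<longleftrightarrow>
     (\<forall>x. h differentiable (at x)) \<and>
     (\<forall>x y. norm (grad h x - grad h y) \<le> \<rho> * norm (x - y))"

text \<open>
  One run of the method along a realised sample sequence \<open>s\<close>. Iterates are indexed by natural
  numbers; since \<open>x 0 = x 1\<close>, truncated subtraction in \<open>x (k - d k)\<close> implements the convention
  that iterates with index \<open>\<le> 0\<close> equal \<open>x 1\<close>.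
\<close>

definition delayed_grad ::
  "(real ^ 'n \<Rightarrow> 's \<Rightarrow> real) \<Rightarrow> (nat \<Rightarrow> 's) \<Rightarrow> (nat \<Rightarrow> nat) \<Rightarrow> (nat \<Rightarrow> real ^ 'n) \<Rightarrow> nat \<Rightarrow> real ^ 'n"
where
  "delayed_grad f s d x k = grad (\<lambda>y. f y (s k)) (x (k - d k))"

definition inertial_run ::
  "(real ^ 'n \<Rightarrow> 's \<Rightarrow> real) \<Rightarrow> (nat \<Rightarrow> 's) \<Rightarrow> (nat \<Rightarrow> nat) \<Rightarrow> (nat \<Rightarrow> real) \<Rightarrow> real \<Rightarrow>
    real ^ 'n \<Rightarrow> (nat \<Rightarrow> real ^ 'n) \<Rightarrow> bool"
where
  "inertial_run f s d \<alpha> \<beta> x0 x \<longleftrightarrow>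
     x 0 = x0 \<and> x 1 = x0 \<and>
     (\<forall>k\<ge>1. x (k + 1) = x k - \<alpha> k *\<^sub>R delayed_grad f s d x k
                         + (\<alpha> k / \<alpha> (k - 1) * \<beta>) *\<^sub>R (x k - x (k - 1)))"

text \<open>
  The sub-\<open>\<sigma>\<close>-algebra of \<open>M\<close> generated by the samples \<open>\<xi> j\<close> with \<open>j \<in> I\<close>. The past at step \<open>k\<close>
  is the case \<open>I = {1..<k}\<close>.
\<close>

definition sample_algebra ::
  "'w measure \<Rightarrow> 's measure \<Rightarrow> (nat \<Rightarrow> 'w \<Rightarrow> 's) \<Rightarrow> nat set \<Rightarrow> 'w measure"
where
  "sample_algebra M D \<xi> I =
     vimage_algebra (space M) (\<lambda>\<omega>. \<lambda>j\<in>I. \<xi> j \<omega>) (Pi\<^sub>M I (\<lambda>_. D))"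

end

theory Submission
  imports Defs
begin

text \<open>
  Write \<open>a = \<alpha> / sqrt K\<close> for the constant step and \<open>\<eta> = a / (1 - \<beta>)\<close>.  The momentum is removed by
  following the auxiliary sequence \<open>z k = x 1 - \<eta> * (g 1 + ... + g (k - 1))\<close>, which performs plain
  gradient descent with step \<open>\<eta>\<close>.  Solving the inertial recursion
  (\<open>inertial_closed_form\<close>) shows that \<open>z k - x (k - d)\<close> is \<open>- \<eta>\<close> times the sum of the past gradients
  \<open>g j\<close> with weights \<open>\<beta> ^ (k - j - d)\<close> in truncated subtraction.  The case \<open>d = 0\<close> measures the effect of momentum
  alone, the case \<open>d = \<tau>\<^sub>k\<close> that of momentum and delay together.

  The descent lemma for \<open>F\<close> along \<open>z\<close> contains the product of \<open>u = grad F (z k)\<close> with the stale gradient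
  \<open>h = grad F (x (k - \<tau>\<^sub>k))\<close>.  By polarization (\<open>gradient_product_bound\<close>) each step decreases \<open>F\<close> in
  expectation by a quarter of \<open>\<eta>\<close> times the squared gradient at \<open>x k\<close> plus half of \<open>\<eta>\<close> times the squared norm
  of \<open>h\<close>, up to errors that smoothness bounds by the two weighted sums above, and up to the second-order
  term of the descent lemma.

  In a weighted sum every gradient is a stale gradient plus noise.  Noise vectors of different steps are
  orthogonal, so the noise contributes only the sum of the squared weights, at most
  \<open>\<tau> + \<beta>\<^sup>2 / (1 - \<beta>\<^sup>2)\<close>; these contributions give the terms with \<open>\<sigma>\<^sup>2\<close>.  The stale gradients contribute
  the square of the sum of the weights, at most \<open>\<tau> + \<beta> / (1 - \<beta>)\<close>, times the sum of their squared norms over all steps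
  (\<open>lagged_gradient_sum_bound\<close>, \<open>lagged_double_sum_le\<close>).  The two step-size conditions let
  the term in \<open>h\<close> absorb these contributions (\<open>drift_coefficient_bound\<close>).
  Telescoping gives \<open>gradient_sum_bound\<close>, and since the random index is uniform and independent of the
  samples, the average over the steps is the expectation at the random iterate.

  On the probabilistic side, the sampled gradient is jointly measurable in point and sample, so every
  iterate is a function of the earlier samples.  The pointwise variance bound then transfers to the
  random point at which the gradient is sampled, by Fubini.
\<close>

section \<open>Gradients of smooth functions\<close>

lemma differentiable_imp_GDERIV_grad:
  fixes h :: "real ^ 'n \<Rightarrow> real"
  assumes "h differentiable (at x)"
  shows "GDERIV h x :> grad h x"
proof -
  obtain h' where h': "(h has_derivative h') (at x)"
    using assms unfolding differentiable_def by blast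
  interpret bounded_linear h'
    using h' by (rule has_derivative_bounded_linear)
  have "h' v = v \<bullet> (\<Sum>b\<in>Basis. h' b *\<^sub>R b)" for v
  proof -
    have "h' v = h' (\<Sum>b\<in>Basis. (v \<bullet> b) *\<^sub>R b)"
      by (simp add: euclidean_representation)
    also have "\<dots> = (\<Sum>b\<in>Basis. (v \<bullet> b) * h' b)"
      by (simp add: sum scaleR)
    finally show ?thesis
      by (simp add: inner_sum_right mult.commute)
  qed
  then have "h' = (\<lambda>v. v \<bullet> (\<Sum>b\<in>Basis. h' b *\<^sub>R b))" by (rule ext)
  then have D: "GDERIV h x :> (\<Sum>b\<in>Basis. h' b *\<^sub>R b)"
    using h' unfolding gderiv_def by simp
  have "E = E'" if "GDERIV h x :> E" "GDERIV h x :> E'" for E E'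
  proof -
    have "(\<lambda>v. v \<bullet> E) = (\<lambda>v. v \<bullet> E')"
      using that unfolding gderiv_def by (rule has_derivative_unique)
    then have "(E - E') \<bullet> (E - E') = 0"
      by (metis inner_diff_right right_minus_eq)
    then show ?thesis by simp
  qed
  with D show ?thesis
    unfolding grad_def by (intro theI[of "\<lambda>D. GDERIV h x :> D"]) blast+
qed

lemma differentiable_DERIV_along_line:
  fixes h :: "real ^ 'n \<Rightarrow> real"
  assumes "h differentiable (at (x + t *\<^sub>R v))"
  shows "((\<lambda>t. h (x + t *\<^sub>R v)) has_real_derivative (v \<bullet> grad h (x + t *\<^sub>R v))) (at t)"
proof -
  have "(h has_derivative (\<lambda>w. w \<bullet> grad h (x + t *\<^sub>R v))) (at (x + t *\<^sub>R v))"
    using differentiable_imp_GDERIV_grad[OF assms] by (simp add: gderiv_def)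
  moreover have "((\<lambda>t. x + t *\<^sub>R v) has_derivative (\<lambda>s. s *\<^sub>R v)) (at t)"
    by (auto intro!: derivative_eq_intros)
  ultimately have "((\<lambda>t. h (x + t *\<^sub>R v)) has_derivative (\<lambda>s. (s *\<^sub>R v) \<bullet> grad h (x + t *\<^sub>R v))) (at t)"
    by (rule has_derivative_compose[rotated])
  moreover have "(\<lambda>s. (s *\<^sub>R v) \<bullet> grad h (x + t *\<^sub>R v)) = (*) (v \<bullet> grad h (x + t *\<^sub>R v))"
    by (auto simp: mult.commute)
  ultimately show ?thesis
    by (simp add: has_field_derivative_def)
qed

text \<open>
  Along the segment from \<open>x\<close> to \<open>x + v\<close>, the derivative of \<open>h\<close> minus its claimed quadratic
  upper model is nonpositive by Cauchy-Schwarz and the Lipschitz bound on the gradient.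
\<close>

lemma smooth_with_descent:
  fixes h :: "real ^ 'n \<Rightarrow> real"
  assumes h: "smooth_with \<rho> h"
  shows "h (x + v) \<le> h x + v \<bullet> grad h x + \<rho> / 2 * (norm v)\<^sup>2"
proof -
  define \<phi> where "\<phi> t = h (x + t *\<^sub>R v) - t * (v \<bullet> grad h x) - \<rho> / 2 * t\<^sup>2 * (norm v)\<^sup>2" for t
  have "\<phi> 1 \<le> \<phi> 0"
  proof (rule DERIV_nonpos_imp_nonincreasing[of 0 1 \<phi>])
    show "\<exists>y. (\<phi> has_real_derivative y) (at t) \<and> y \<le> 0" if t: "0 \<le> t" "t \<le> 1" for t
    proof (intro exI conjI)
      have "h differentiable (at (x + t *\<^sub>R v))"
        using h by (simp add: smooth_with_def)
      from differentiable_DERIV_along_line[OF this]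
      show "(\<phi> has_real_derivative
          (v \<bullet> grad h (x + t *\<^sub>R v) - v \<bullet> grad h x - \<rho> * t * (norm v)\<^sup>2)) (at t)"
        unfolding \<phi>_def by (auto intro!: derivative_eq_intros simp: field_simps)
      have "v \<bullet> (grad h (x + t *\<^sub>R v) - grad h x) \<le> norm v * norm (grad h (x + t *\<^sub>R v) - grad h x)"
        by (rule norm_cauchy_schwarz)
      also have "\<dots> \<le> norm v * (\<rho> * norm ((x + t *\<^sub>R v) - x))"
        using h unfolding smooth_with_def by (metis mult_left_mono norm_ge_zero)
      also have "\<dots> = \<rho> * t * (norm v)\<^sup>2"
        using t by (simp add: power2_eq_square)
      finally show "v \<bullet> grad h (x + t *\<^sub>R v) - v \<bullet> grad h x - \<rho> * t * (norm v)\<^sup>2 \<le> 0"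
        by (simp add: inner_diff_right)
    qed
  qed simp
  then show ?thesis by (simp add: \<phi>_def)
qed

lemma smooth_with_continuous_grad:
  fixes h :: "real ^ 'n \<Rightarrow> real"
  assumes "smooth_with \<rho> h"
  shows "continuous_on UNIV (grad h)"
proof (rule lipschitz_on_continuous_on)
  show "\<bar>\<rho>\<bar>-lipschitz_on UNIV (grad h)"
  proof (rule lipschitz_onI)
    fix x y :: "real ^ 'n"
    have "norm (grad h x - grad h y) \<le> \<rho> * norm (x - y)"
      using assms by (auto simp: smooth_with_def)
    also have "\<dots> \<le> \<bar>\<rho>\<bar> * norm (x - y)"
      by (intro mult_right_mono) auto
    finally show "dist (grad h x) (grad h y) \<le> \<bar>\<rho>\<bar> * dist x y"
      by (simp add: dist_norm)
  qed simp
qed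

lemma smooth_with_continuous:
  fixes h :: "real ^ 'n \<Rightarrow> real"
  assumes "smooth_with \<rho> h"
  shows "continuous_on UNIV h"
  using assms by (intro differentiable_imp_continuous_on)
    (auto simp: smooth_with_def differentiable_on_def intro: differentiable_at_withinI)

section \<open>Weights and inequalities for the inertial recursion\<close>

text \<open>
  The exponent is truncated subtraction: the first \<open>d\<close> weights are \<open>1\<close>, and the later ones decay
  geometrically.  These are the weights with which past gradients enter the distance between the
  iterates and the auxiliary sequence of the analysis, with \<open>d\<close> the delay.
\<close>

lemma sum_truncated_power_le:
  fixes b :: real
  assumes b: "0 \<le> b" "b < 1"
  shows "(\<Sum>i\<in>{1..m}. b ^ (i - d)) \<le> real d + b / (1 - b)"
proof (cases "m \<le> d")
  case True
  then have "(\<Sum>i\<in>{1..m}. b ^ (i - d)) = real m" by simp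
  moreover have "0 \<le> b / (1 - b)" using b by simp
  ultimately show ?thesis using True by linarith
next
  case False
  then obtain l where l: "m = d + l" using le_Suc_ex nat_le_linear by blast
  have geo: "(\<Sum>i\<in>{1..l}. b ^ i) \<le> b / (1 - b)" for l
  proof -
    have "(\<Sum>i\<in>{1..l}. b ^ i) = (\<Sum>i<l. b * b ^ i)"
      by (rule sum.reindex_bij_witness[of _ Suc "\<lambda>i. i - 1"]) (auto simp flip: power_Suc)
    also have "\<dots> = b * ((1 - b ^ l) / (1 - b))"
      using b by (simp only: sum_distrib_left[symmetric] sum_gp_strict) simp
    also have "\<dots> \<le> b * (1 / (1 - b))"
      using b by (intro mult_left_mono divide_right_mono) auto
    finally show ?thesis by simp
  qed
  have "(\<Sum>i\<in>{1..m}. b ^ (i - d)) = (\<Sum>i\<in>{1..d}. b ^ (i - d)) + (\<Sum>i\<in>{d+1..d+l}. b ^ (i - d))"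
    unfolding l by (rule sum.ub_add_nat[of 1 d "\<lambda>i. b ^ (i - d)" l]) simp
  also have "(\<Sum>i\<in>{d+1..d+l}. b ^ (i - d)) = (\<Sum>i\<in>{1..l}. b ^ i)"
    by (rule sum.reindex_bij_witness[of _ "\<lambda>i. i + d" "\<lambda>i. i - d"]) auto
  also have "(\<Sum>i\<in>{1..d}. b ^ (i - d)) = real d"
    by simp
  finally show ?thesis using geo[of l] by linarith
qed

lemma weighted_sum_norm_square_le:
  fixes w :: "'i \<Rightarrow> real" and v :: "'i \<Rightarrow> 'a :: real_inner"
  assumes w: "\<And>i. i \<in> I \<Longrightarrow> 0 \<le> w i"
  shows "(norm (\<Sum>i\<in>I. w i *\<^sub>R v i))\<^sup>2 \<le> (\<Sum>i\<in>I. w i) * (\<Sum>i\<in>I. w i * (norm (v i))\<^sup>2)"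
proof -
  have "norm (\<Sum>i\<in>I. w i *\<^sub>R v i) \<le> (\<Sum>i\<in>I. w i * norm (v i))"
    using w by (intro order_trans[OF norm_sum]) (simp add: sum_mono)
  also have "\<dots> = (\<Sum>i\<in>I. sqrt (w i) * (sqrt (w i) * norm (v i)))"
    using w by (intro sum.cong) (auto simp: mult.assoc[symmetric])
  finally have "(norm (\<Sum>i\<in>I. w i *\<^sub>R v i))\<^sup>2 \<le> (\<Sum>i\<in>I. sqrt (w i) * (sqrt (w i) * norm (v i)))\<^sup>2"
    by (intro power_mono) auto
  also have "\<dots> \<le> (\<Sum>i\<in>I. (sqrt (w i))\<^sup>2) * (\<Sum>i\<in>I. (sqrt (w i) * norm (v i))\<^sup>2)"
    by (rule Cauchy_Schwarz_ineq_sum)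
  also have "\<dots> = (\<Sum>i\<in>I. w i) * (\<Sum>i\<in>I. w i * (norm (v i))\<^sup>2)"
    using w by (simp add: power_mult_distrib)
  finally show ?thesis .
qed

text \<open>
  Young's inequality with ratio \<open>4/3\<close>.  In the application \<open>u\<close> is noise and \<open>v\<close> is drift.
  The constant \<open>7/3\<close> in front of the noise is small enough to be covered by the noise
  terms of the final bound, and \<open>7/4\<close> in front of the drift is small enough to be
  absorbed under the step-size conditions; with the even split \<open>2, 2\<close> the absorption can fail
  when the delay is large.
\<close>

lemma norm_add_square_le:
  fixes u v :: "'a :: real_inner"
  shows "(norm (u + v))\<^sup>2 \<le> 7 / 3 * (norm u)\<^sup>2 + 7 / 4 * (norm v)\<^sup>2"
proof -
  have "0 \<le> (norm (4 *\<^sub>R u - 3 *\<^sub>R v))\<^sup>2" by simp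
  also have "\<dots> = 16 * (u \<bullet> u) - 24 * (u \<bullet> v) + 9 * (v \<bullet> v)"
    by (simp add: power2_norm_eq_inner inner_diff_left inner_diff_right inner_commute)
  finally show ?thesis
    by (simp add: power2_norm_eq_inner inner_add_left inner_add_right inner_commute)
qed

text \<open>
  Polarization of \<open>u \<bullet> h\<close>, followed by trading \<open>- (norm u)\<^sup>2 / 2\<close> for \<open>- (norm q)\<^sup>2 / 4\<close>.  Here \<open>u\<close> is
  the gradient at the auxiliary point, \<open>h\<close> the stale gradient that drives the step, and \<open>q\<close> the
  gradient at the current iterate, which is the quantity to be bounded.  The negative term in \<open>h\<close> pays
  for the drift terms.
\<close>

lemma gradient_product_bound:
  fixes u q h :: "'a :: real_inner"
  shows "- (u \<bullet> h) \<le> - (norm q)\<^sup>2 / 4 + (norm (u - q))\<^sup>2 / 2 - (norm h)\<^sup>2 / 2 + (norm (u - h))\<^sup>2 / 2"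
proof -
  have "(norm q)\<^sup>2 \<le> 2 * (norm u)\<^sup>2 + 2 * (norm (u - q))\<^sup>2"
  proof -
    have "0 \<le> (norm (u + (u - q)))\<^sup>2" by simp
    then show ?thesis
      by (simp add: power2_norm_eq_inner inner_diff_left inner_diff_right inner_add_left
        inner_add_right inner_commute)
  qed
  then show ?thesis
    by (simp add: power2_norm_eq_inner inner_diff_left inner_diff_right inner_commute field_simps)
qed

text \<open>
  With \<open>z k = x 1 - \<eta> *\<^sub>R (\<Sum>j\<in>{1..<k}. g j)\<close>, the combination \<open>x (k + 1) - \<beta> *\<^sub>R x k\<close> moves by
  \<open>- (1 - \<beta>) * \<eta>\<close> times the current gradient and hence equals \<open>(1 - \<beta>) *\<^sub>R z (k + 1)\<close>.
  So each iterate is a convex combination of its predecessor and of plain gradient descent \<open>z\<close>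
  with step \<open>\<eta>\<close>, and unrolling this gives the formula.
\<close>

lemma inertial_closed_form:
  fixes x g :: "nat \<Rightarrow> 'a :: real_vector"
  assumes x0: "x 0 = x 1"
    and step: "\<And>k. k \<in> {1..K} \<Longrightarrow>
      x (Suc k) = x k - ((1 - \<beta>) * \<eta>) *\<^sub>R g k + \<beta> *\<^sub>R (x k - x (k - 1))"
    and k: "k \<le> K"
  shows "x (Suc k) = x 1 - \<eta> *\<^sub>R (\<Sum>j\<in>{1..k}. (1 - \<beta> ^ (Suc k - j)) *\<^sub>R g j)"
proof -
  have inv: "x (Suc k) - \<beta> *\<^sub>R x k = (1 - \<beta>) *\<^sub>R (x 1 - \<eta> *\<^sub>R (\<Sum>j\<in>{1..k}. g j))" if "k \<le> K" for k
    using that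
  proof (induction k)
    case 0
    then show ?case by (simp add: x0 scaleR_left_diff_distrib)
  next
    case (Suc k)
    have "x (Suc (Suc k)) - \<beta> *\<^sub>R x (Suc k) = (x (Suc k) - \<beta> *\<^sub>R x k) - ((1 - \<beta>) * \<eta>) *\<^sub>R g (Suc k)"
      using step[of "Suc k"] Suc.prems by (simp add: algebra_simps)
    also have "\<dots> = (1 - \<beta>) *\<^sub>R (x 1 - \<eta> *\<^sub>R (\<Sum>j\<in>{1..Suc k}. g j))"
      using Suc by (simp add: scaleR_right_distrib scaleR_right_diff_distrib)
    finally show ?case .
  qed
  have combine: "\<beta> *\<^sub>R (p - \<eta> *\<^sub>R a) + (1 - \<beta>) *\<^sub>R (p - \<eta> *\<^sub>R (s + c))
      = p - \<eta> *\<^sub>R ((\<beta> *\<^sub>R a + (1 - \<beta>) *\<^sub>R s) + (1 - \<beta>) *\<^sub>R c)" for p a s c :: 'a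
    by (simp add: algebra_simps)
  show ?thesis using k
  proof (induction k)
    case 0
    show ?case by simp
  next
    case (Suc k)
    let ?A = "\<Sum>j\<in>{1..k}. (1 - \<beta> ^ (Suc k - j)) *\<^sub>R g j"
    let ?B = "\<Sum>j\<in>{1..k}. (1 - \<beta> ^ (Suc (Suc k) - j)) *\<^sub>R g j"
    let ?S = "\<Sum>j\<in>{1..k}. g j"
    have B: "?B = \<beta> *\<^sub>R ?A + (1 - \<beta>) *\<^sub>R ?S"
      unfolding scaleR_sum_right sum.distrib[symmetric]
      by (intro sum.cong) (auto simp: Suc_diff_le algebra_simps)
    have "x (Suc (Suc k)) = \<beta> *\<^sub>R x (Suc k) + (1 - \<beta>) *\<^sub>R (x 1 - \<eta> *\<^sub>R (?S + g (Suc k)))"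
      using inv[OF Suc.prems] by (simp add: algebra_simps)
    also have "x (Suc k) = x 1 - \<eta> *\<^sub>R ?A"
      using Suc by simp
    also have "\<beta> *\<^sub>R (x 1 - \<eta> *\<^sub>R ?A) + (1 - \<beta>) *\<^sub>R (x 1 - \<eta> *\<^sub>R (?S + g (Suc k)))
        = x 1 - \<eta> *\<^sub>R (?B + (1 - \<beta>) *\<^sub>R g (Suc k))"
      unfolding B by (rule combine)
    also have "?B + (1 - \<beta>) *\<^sub>R g (Suc k) = (\<Sum>j\<in>{1..Suc k}. (1 - \<beta> ^ (Suc (Suc k) - j)) *\<^sub>R g j)"
      by simp
    finally show ?case .
  qed
qed

text \<open>
  After exchanging the sums, each \<open>H j\<close> is multiplied by a sum of truncated powers.
\<close>

lemma lagged_double_sum_le: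
  fixes H :: "nat \<Rightarrow> real"
  assumes b: "0 \<le> b" "b < 1" and H: "\<And>j. 0 \<le> H j"
  shows "(\<Sum>k\<in>{1..K}. \<Sum>j\<in>{1..<k}. b ^ (k - j - d) * H j)
    \<le> (real d + b / (1 - b)) * (\<Sum>j\<in>{1..K}. H j)"
proof -
  have "(\<Sum>k\<in>{1..K}. \<Sum>j\<in>{1..<k}. b ^ (k - j - d) * H j)
      = (\<Sum>k\<in>{1..K}. \<Sum>j\<in>{j \<in> {1..K}. j < k}. b ^ (k - j - d) * H j)"
    by (intro sum.cong) auto
  also have "\<dots> = (\<Sum>j\<in>{1..K}. \<Sum>k\<in>{k \<in> {1..K}. j < k}. b ^ (k - j - d) * H j)"
    by (rule sum.swap_restrict) auto
  also have "\<dots> = (\<Sum>j\<in>{1..K}. (\<Sum>i\<in>{1..K - j}. b ^ (i - d)) * H j)"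
  proof (rule sum.cong[OF refl])
    fix j assume "j \<in> {1..K}"
    then have "(\<Sum>k\<in>{k \<in> {1..K}. j < k}. b ^ (k - j - d)) = (\<Sum>i\<in>{1..K - j}. b ^ (i - d))"
      by (intro sum.reindex_bij_witness[of _ "\<lambda>i. i + j" "\<lambda>k. k - j"]) auto
    then show "(\<Sum>k\<in>{k \<in> {1..K}. j < k}. b ^ (k - j - d) * H j)
        = (\<Sum>i\<in>{1..K - j}. b ^ (i - d)) * H j"
      by (simp only: sum_distrib_right[symmetric])
  qed
  also have "\<dots> \<le> (\<Sum>j\<in>{1..K}. (real d + b / (1 - b)) * H j)"
    using b H by (intro sum_mono mult_right_mono sum_truncated_power_le) auto
  finally show ?thesis by (simp only: sum_distrib_left)
qed

section \<open>Consequences of the step-size conditions\<close>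

text \<open>
  The real inequality behind the step-size conditions, in the scale-free quantities
  \<open>t = \<rho> * \<eta> * \<tau>\<close>, \<open>p = \<rho> * \<eta> * \<beta> / (1 - \<beta>)\<close> and \<open>e = \<rho> * \<eta>\<close>.  The left side of the conclusion
  is the total cost of the drift caused by delay, by momentum and by curvature.  The second
  hypothesis makes \<open>p\<close> and \<open>e\<close> small.  For small \<open>t\<close> this suffices; for
  \<open>t > 1/2\<close> the first hypothesis replaces \<open>t\<^sup>2 + 2 * t * p\<close> by \<open>1 / 2 + t * (p - e)\<close>.
\<close>

lemma step_size_drift_budget:
  fixes t p e :: real
  assumes t: "0 \<le> t" and p: "0 \<le> p" and e: "0 \<le> e"
    and c1: "t\<^sup>2 + t * p + t * e \<le> 1 / 2"
    and c2: "p\<^sup>2 \<le> e * (1 / 10 - 3 / 5 * e)"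
  shows "7 / 4 * (t + p)\<^sup>2 + 7 / 4 * p\<^sup>2 + e \<le> 1"
proof -
  have e6: "e \<le> 1 / 6"
  proof (rule ccontr)
    assume "\<not> e \<le> 1 / 6"
    then have "e * (1 / 10 - 3 / 5 * e) < 0"
      by (intro mult_pos_neg) auto
    with c2 show False using zero_le_power2[of p] by linarith
  qed
  \<comment> \<open>The quadratic bound on \<open>p\<^sup>2\<close> is largest at \<open>e = 1 / 12\<close>.\<close>
  have "e * (1 / 10 - 3 / 5 * e) = 1 / 240 - 3 / 5 * (e - 1 / 12)\<^sup>2"
    by (simp add: power2_eq_square algebra_simps)
  then have psq: "p\<^sup>2 \<le> 1 / 240"
    using c2 zero_le_power2[of "e - 1 / 12"] by linarith
  then have "p\<^sup>2 \<le> (1 / 15)\<^sup>2" by (simp add: power2_eq_square)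
  then have p15: "p \<le> 1 / 15"
    by (rule power2_le_imp_le) simp
  show ?thesis
  proof (cases "t \<le> 1 / 2")
    case True
    have "t\<^sup>2 \<le> 1 / 4"
      using power_mono[OF True t, of 2] by (simp add: power2_eq_square)
    moreover have "t * p \<le> 1 / 2 * (1 / 15)"
      using True p15 t p by (intro mult_mono) auto
    moreover have "(t + p)\<^sup>2 = t\<^sup>2 + 2 * (t * p) + p\<^sup>2"
      by (simp add: power2_sum)
    ultimately show ?thesis
      using psq e6 by linarith
  next
    case False
    define m where "m = t\<^sup>2 + t * p + t * e"
    define q where "q = t * (p - e)"
    have "7 / 4 * (t + p)\<^sup>2 + 7 / 4 * p\<^sup>2 + e = 7 / 4 * m + 7 / 4 * q + 7 / 2 * p\<^sup>2 + e"
      unfolding m_def q_def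
      by (simp add: power2_sum field_simps)
    moreover have "7 / 4 * q + e \<le> 21 / 16 * p + 1 / 8 * e"
    proof (cases "p \<le> e")
      case True
      then have "t * (p - e) \<le> 1 / 2 * (p - e)"
        using False by (intro mult_right_mono_neg) auto
      then show ?thesis unfolding q_def[symmetric] using p by simp
    next
      case pe: False
      have "t\<^sup>2 \<le> 1 / 2" using c1 mult_nonneg_nonneg[OF t p] mult_nonneg_nonneg[OF t e] by linarith
      then have "t\<^sup>2 \<le> (3 / 4)\<^sup>2" by (simp add: power2_eq_square)
      then have "t \<le> 3 / 4" by (rule power2_le_imp_le) simp
      then have "t * (p - e) \<le> 3 / 4 * (p - e)"
        using pe by (intro mult_right_mono) auto
      then show ?thesis unfolding q_def[symmetric] using e by simp
    qed
    moreover have "m \<le> 1 / 2" using c1 by (simp add: m_def)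
    ultimately show ?thesis using psq p15 e6 by linarith
  qed
qed

text \<open>
  The scale-free form of the step-size conditions is the first one multiplied by \<open>(\<rho> * \<eta>)\<^sup>2\<close> and the
  second one multiplied by \<open>\<eta>\<close>.  The square of \<open>\<beta> / (1 - \<beta>)\<close> enters through
  \<open>(1 - \<beta>) * (1 - \<beta>\<^sup>2) \<le> 2 * (1 - \<beta>)\<^sup>2\<close>.
\<close>

lemma drift_coefficient_bound:
  fixes \<tau> \<beta> \<eta> \<rho> :: real
  assumes tau: "0 \<le> \<tau>" and beta: "0 < \<beta>" "\<beta> < 1" and pos: "0 < \<eta>" "0 < \<rho>"
    and c1: "\<tau>\<^sup>2 + \<tau> / (1 - \<beta>) + \<beta>\<^sup>2 / (1 - \<beta>\<^sup>2) \<le> 1 / (2 * \<eta>\<^sup>2 * \<rho>\<^sup>2)"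
    and c2: "3 * \<rho> + 2 * (1 + 5 * \<rho>) * \<beta>\<^sup>2 / ((1 - \<beta>) * (1 - \<beta>\<^sup>2)) \<le> 1 / (2 * \<eta>)"
  shows "7 / 4 * (\<rho> * \<eta>)\<^sup>2 * ((\<tau> + \<beta> / (1 - \<beta>))\<^sup>2 + (\<beta> / (1 - \<beta>))\<^sup>2) + \<rho> * \<eta> \<le> 1"
    and "\<rho> * \<eta> * \<tau> \<le> 3 / 4" and "\<rho> * \<eta> \<le> 1 / 6"
proof -
  define e b where "e = \<rho> * \<eta>" and "b = \<beta> / (1 - \<beta>)"
  have e: "0 < e" and b: "0 < b" using pos beta by (auto simp: e_def b_def)
  have bb: "\<beta>\<^sup>2 < 1" using beta by (simp add: power_less_one_iff)
  then have B: "0 \<le> \<beta>\<^sup>2 / (1 - \<beta>\<^sup>2)" by simp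
  have inv: "1 / (1 - \<beta>) = 1 + b" using beta by (simp add: b_def field_simps)
  have "\<tau>\<^sup>2 + \<tau> * (1 + b) \<le> 1 / (2 * e\<^sup>2)"
    using c1 B unfolding inv[symmetric] by (simp add: e_def power_mult_distrib mult_ac)
  then have "e\<^sup>2 * (\<tau>\<^sup>2 + \<tau> * (1 + b)) \<le> e\<^sup>2 * (1 / (2 * e\<^sup>2))"
    by (rule mult_left_mono) simp
  also have "\<dots> = 1 / 2" using e by simp
  finally have A1: "(e * \<tau>)\<^sup>2 + (e * \<tau>) * (e * b) + (e * \<tau>) * e \<le> 1 / 2"
    by (simp add: power2_eq_square algebra_simps)
  have X: "b\<^sup>2 / 2 \<le> \<beta>\<^sup>2 / ((1 - \<beta>) * (1 - \<beta>\<^sup>2))"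
  proof -
    have "(1 - \<beta>) * (1 - \<beta>\<^sup>2) = (1 - \<beta>)\<^sup>2 * (1 + \<beta>)"
      by (simp add: power2_eq_square algebra_simps)
    also have "\<dots> \<le> (1 - \<beta>)\<^sup>2 * 2"
      using beta by (intro mult_left_mono) auto
    finally have "\<beta>\<^sup>2 / ((1 - \<beta>)\<^sup>2 * 2) \<le> \<beta>\<^sup>2 / ((1 - \<beta>) * (1 - \<beta>\<^sup>2))"
      using beta bb by (intro divide_left_mono) auto
    then show ?thesis by (simp add: b_def power_divide)
  qed
  have "3 * \<rho> + 5 * \<rho> * b\<^sup>2 \<le> 3 * \<rho> + 2 * (1 + 5 * \<rho>) * (b\<^sup>2 / 2)"
    using pos by (simp add: algebra_simps)
  also have "\<dots> \<le> 3 * \<rho> + 2 * (1 + 5 * \<rho>) * (\<beta>\<^sup>2 / ((1 - \<beta>) * (1 - \<beta>\<^sup>2)))"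
    using X pos by (intro add_left_mono mult_left_mono) auto
  also have "\<dots> \<le> 1 / (2 * \<eta>)" using c2 by simp
  finally have "\<eta> * (3 * \<rho> + 5 * \<rho> * b\<^sup>2) \<le> \<eta> * (1 / (2 * \<eta>))"
    using pos by (intro mult_left_mono) auto
  also have "\<dots> = 1 / 2" using pos by simp
  finally have A2: "3 * e + 5 * (e * b\<^sup>2) \<le> 1 / 2"
    by (simp add: e_def algebra_simps)
  have "e * (e * b\<^sup>2) \<le> e * (1 / 10 - 3 / 5 * e)"
    using A2 e by (intro mult_left_mono) auto
  then have "(e * b)\<^sup>2 \<le> e * (1 / 10 - 3 / 5 * e)"
    by (simp add: power2_eq_square mult_ac)
  then have "7 / 4 * (e * \<tau> + e * b)\<^sup>2 + 7 / 4 * (e * b)\<^sup>2 + e \<le> 1"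
    using A1 e b tau by (intro step_size_drift_budget) auto
  then have "7 / 4 * e\<^sup>2 * ((\<tau> + b)\<^sup>2 + b\<^sup>2) + e \<le> 1"
    by (simp add: power2_eq_square algebra_simps)
  then show "7 / 4 * (\<rho> * \<eta>)\<^sup>2 * ((\<tau> + \<beta> / (1 - \<beta>))\<^sup>2 + (\<beta> / (1 - \<beta>))\<^sup>2) + \<rho> * \<eta> \<le> 1"
    by (simp add: e_def b_def)
  have "0 \<le> (e * \<tau>) * (e * b)" "0 \<le> (e * \<tau>) * e" using e b tau by auto
  then have "(e * \<tau>)\<^sup>2 \<le> 1 / 2" using A1 by linarith
  then have "(e * \<tau>)\<^sup>2 \<le> (3 / 4)\<^sup>2" by (simp add: power2_eq_square)
  then have "e * \<tau> \<le> 3 / 4" by (rule power2_le_imp_le) simp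
  then show "\<rho> * \<eta> * \<tau> \<le> 3 / 4" by (simp add: e_def)
  have "0 \<le> e * b\<^sup>2" using e by simp
  then show "\<rho> * \<eta> \<le> 1 / 6" using A2 by (simp add: e_def)
qed

text \<open>
  The left side is the noise produced in one step.  The factor \<open>7/3\<close> inflates the delay part
  \<open>\<rho> * \<eta> * \<tau> / 2\<close>, and the excess is covered by one half of the curvature term \<open>\<rho>\<close>; the
  descent lemma takes the other half.
\<close>

lemma noise_coefficient_bound:
  fixes \<tau> B \<eta> \<rho> s :: real
  assumes B: "0 \<le> B" and pos: "0 < \<rho>" and s: "0 \<le> s"
    and t: "\<rho> * \<eta> * \<tau> \<le> 3 / 4" and e: "\<rho> * \<eta> \<le> 1 / 6"
  shows "\<eta> / 2 * (\<rho>\<^sup>2 * \<eta>\<^sup>2 * (7 / 3 * (s * B) + 7 / 3 * (s * (\<tau> + B)))) + \<rho> / 2 * \<eta>\<^sup>2 * s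
    \<le> \<eta>\<^sup>2 * s * (\<rho>\<^sup>2 * \<eta> * \<tau> / 2 + (1 + 5 * \<rho>) * B / 2 + \<rho>)"
proof -
  have "\<rho> * \<eta> * B \<le> 1 / 6 * B" using e B by (rule mult_right_mono)
  then have "7 / 6 * (\<rho> * \<eta> * \<tau>) + 7 / 3 * (\<rho> * \<eta> * B) + 1 / 2 \<le> \<rho> * \<eta> * \<tau> / 2 + 5 / 2 * B + 1"
    using t B by linarith
  then have "\<rho> * (7 / 6 * (\<rho> * \<eta> * \<tau>) + 7 / 3 * (\<rho> * \<eta> * B) + 1 / 2) \<le> \<rho> * (\<rho> * \<eta> * \<tau> / 2 + 5 / 2 * B + 1)"
    using pos by (intro mult_left_mono) auto
  also have "\<dots> \<le> \<rho>\<^sup>2 * \<eta> * \<tau> / 2 + (1 + 5 * \<rho>) * B / 2 + \<rho>"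
    using B by (simp add: power2_eq_square algebra_simps)
  finally have "\<eta>\<^sup>2 * s * (\<rho> * (7 / 6 * (\<rho> * \<eta> * \<tau>) + 7 / 3 * (\<rho> * \<eta> * B) + 1 / 2))
      \<le> \<eta>\<^sup>2 * s * (\<rho>\<^sup>2 * \<eta> * \<tau> / 2 + (1 + 5 * \<rho>) * B / 2 + \<rho>)"
    using s by (intro mult_left_mono) auto
  moreover have "\<eta> / 2 * (\<rho>\<^sup>2 * \<eta>\<^sup>2 * (7 / 3 * (s * B) + 7 / 3 * (s * (\<tau> + B)))) + \<rho> / 2 * \<eta>\<^sup>2 * s
      = \<eta>\<^sup>2 * s * (\<rho> * (7 / 6 * (\<rho> * \<eta> * \<tau>) + 7 / 3 * (\<rho> * \<eta> * B) + 1 / 2))"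
    by (simp add: power2_eq_square field_simps)
  ultimately show ?thesis by simp
qed

section \<open>Square-integrable random vectors\<close>

definition square_integrable :: "'w measure \<Rightarrow> ('w \<Rightarrow> 'a :: euclidean_space) \<Rightarrow> bool" where
  "square_integrable M Y \<longleftrightarrow> Y \<in> borel_measurable M \<and> integrable M (\<lambda>\<omega>. (norm (Y \<omega>))\<^sup>2)"

lemma square_integrable_measurable:
  "square_integrable M Y \<Longrightarrow> Y \<in> borel_measurable M"
  by (simp add: square_integrable_def)

lemma square_integrable_integrable:
  "square_integrable M Y \<Longrightarrow> integrable M (\<lambda>\<omega>. (norm (Y \<omega>))\<^sup>2)"
  by (simp add: square_integrable_def)

lemma square_integrable_cong:
  assumes "\<And>\<omega>. \<omega> \<in> space M \<Longrightarrow> Y \<omega> = Z \<omega>"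
  shows "square_integrable M Y \<longleftrightarrow> square_integrable M Z"
  unfolding square_integrable_def
  using assms by (intro arg_cong2[where f = "(\<and>)"] measurable_cong Bochner_Integration.integrable_cong) auto

lemma square_integrable_dominated:
  assumes Y: "Y \<in> borel_measurable M" and b: "integrable M b"
    and le: "\<And>\<omega>. \<omega> \<in> space M \<Longrightarrow> (norm (Y \<omega>))\<^sup>2 \<le> b \<omega>"
  shows "square_integrable M Y"
  unfolding square_integrable_def
proof
  show "integrable M (\<lambda>\<omega>. (norm (Y \<omega>))\<^sup>2)"
    using b by (rule Bochner_Integration.integrable_bound) (use Y le in \<open>auto intro!: AE_I2 order_trans[OF le abs_ge_self]\<close>)
qed (fact Y)

lemma square_integrable_add:
  assumes "square_integrable M Y" "square_integrable M Z"
  shows "square_integrable M (\<lambda>\<omega>. Y \<omega> + Z \<omega>)"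
  using assms norm_add_square_le
  by (intro square_integrable_dominated[where b = "\<lambda>\<omega>. 7 / 3 * (norm (Y \<omega>))\<^sup>2 + 7 / 4 * (norm (Z \<omega>))\<^sup>2"])
    (auto simp: square_integrable_def)

lemma square_integrable_scaleR:
  assumes "square_integrable M Y"
  shows "square_integrable M (\<lambda>\<omega>. c *\<^sub>R Y \<omega>)"
  using assms by (auto simp: square_integrable_def power_mult_distrib)

lemma square_integrable_diff:
  assumes "square_integrable M Y" "square_integrable M Z"
  shows "square_integrable M (\<lambda>\<omega>. Y \<omega> - Z \<omega>)"
  using square_integrable_add[OF assms(1) square_integrable_scaleR[OF assms(2), of "-1"]] by simp

lemma (in finite_measure) square_integrable_const: "square_integrable M (\<lambda>\<omega>. c)"
  by (simp add: square_integrable_def)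

lemma (in finite_measure) square_integrable_sum:
  assumes "\<And>i. i \<in> I \<Longrightarrow> square_integrable M (Y i)"
  shows "square_integrable M (\<lambda>\<omega>. \<Sum>i\<in>I. Y i \<omega>)"
  using assms
  by (induction I rule: infinite_finite_induct) (auto intro: square_integrable_add square_integrable_const)

lemma square_integrable_inner:
  assumes "square_integrable M Y" "square_integrable M Z"
  shows "integrable M (\<lambda>\<omega>. Y \<omega> \<bullet> Z \<omega>)"
proof (rule Bochner_Integration.integrable_bound)
  show "integrable M (\<lambda>\<omega>. (norm (Y \<omega>))\<^sup>2 + (norm (Z \<omega>))\<^sup>2)"
    using assms by (auto simp: square_integrable_def)
  show "(\<lambda>\<omega>. Y \<omega> \<bullet> Z \<omega>) \<in> borel_measurable M"
    using assms by (auto simp: square_integrable_def)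
  have "\<bar>y \<bullet> z\<bar> \<le> (norm y)\<^sup>2 + (norm z)\<^sup>2" for y z :: 'b
  proof -
    have "\<bar>y \<bullet> z\<bar> \<le> norm y * norm z" by (rule Cauchy_Schwarz_ineq2)
    also have "\<dots> \<le> (norm y)\<^sup>2 + (norm z)\<^sup>2"
      using sum_squares_bound[of "norm y" "norm z"] mult_nonneg_nonneg[OF norm_ge_zero[of y] norm_ge_zero[of z]]
      by linarith
    finally show ?thesis .
  qed
  then show "AE \<omega> in M. norm (Y \<omega> \<bullet> Z \<omega>) \<le> norm ((norm (Y \<omega>))\<^sup>2 + (norm (Z \<omega>))\<^sup>2)"
    by (auto intro!: AE_I2)
qed

lemma borel_measurable_vec_component:
  fixes Y :: "'w \<Rightarrow> real ^ 'n"
  assumes "Y \<in> borel_measurable M"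
  shows "(\<lambda>\<omega>. Y \<omega> $ i) \<in> borel_measurable M"
proof -
  have "(\<lambda>\<omega>. Y \<omega> \<bullet> axis i 1) \<in> borel_measurable M"
    using assms by measurable
  then show ?thesis by (simp add: inner_axis)
qed

lemma square_integrable_component:
  fixes Y :: "'w \<Rightarrow> real ^ 'n"
  assumes "square_integrable M Y"
  shows "square_integrable M (\<lambda>\<omega>. Y \<omega> $ i)"
proof (rule square_integrable_dominated[OF _ square_integrable_integrable[OF assms]])
  show "(\<lambda>\<omega>. Y \<omega> $ i) \<in> borel_measurable M"
    using square_integrable_measurable[OF assms] by (rule borel_measurable_vec_component)
  show "(norm (Y \<omega> $ i))\<^sup>2 \<le> (norm (Y \<omega>))\<^sup>2" for \<omega>
    using power_mono[OF component_le_norm_cart[of "Y \<omega>" i], of 2] by simp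
qed

lemma square_integrable_if_nn_integral_le:
  fixes Y :: "'w \<Rightarrow> 'a :: euclidean_space"
  assumes Y: "Y \<in> borel_measurable M" and c: "0 \<le> c"
    and le: "(\<integral>\<^sup>+\<omega>. ennreal ((norm (Y \<omega>))\<^sup>2) \<partial>M) \<le> ennreal c"
  shows "square_integrable M Y" and "(\<integral>\<omega>. (norm (Y \<omega>))\<^sup>2 \<partial>M) \<le> c"
proof -
  have "integrable M (\<lambda>\<omega>. (norm (Y \<omega>))\<^sup>2)"
    using Y le by (intro integrableI_nonneg) (auto intro: le_less_trans)
  then show "square_integrable M Y" using Y by (simp add: square_integrable_def)
  from nn_integral_eq_integral[OF \<open>integrable M (\<lambda>\<omega>. (norm (Y \<omega>))\<^sup>2)\<close>]
  show "(\<integral>\<omega>. (norm (Y \<omega>))\<^sup>2 \<partial>M) \<le> c"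
    using le c by simp
qed

lemma smooth_with_grad_measurable:
  assumes "smooth_with \<rho> (F :: real ^ 'n \<Rightarrow> real)"
  shows "grad F \<in> borel_measurable borel"
  using smooth_with_continuous_grad[OF assms] by (rule borel_measurable_continuous_onI)

lemma (in finite_measure) square_integrable_grad:
  fixes F :: "real ^ 'n \<Rightarrow> real"
  assumes F: "smooth_with \<rho> F" and X: "square_integrable M X"
  shows "square_integrable M (\<lambda>\<omega>. grad F (X \<omega>))"
proof -
  note [measurable] = smooth_with_grad_measurable[OF F] square_integrable_measurable[OF X]
  have "square_integrable M (\<lambda>\<omega>. grad F (X \<omega>) - grad F 0)"
  proof (rule square_integrable_dominated)
    show "integrable M (\<lambda>\<omega>. \<rho>\<^sup>2 * (norm (X \<omega>))\<^sup>2)"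
      using square_integrable_integrable[OF X] by simp
    fix \<omega>
    have "norm (grad F (X \<omega>) - grad F 0) \<le> \<rho> * norm (X \<omega>)"
      using F unfolding smooth_with_def by (metis diff_zero)
    then have "(norm (grad F (X \<omega>) - grad F 0))\<^sup>2 \<le> (\<rho> * norm (X \<omega>))\<^sup>2"
      by (rule power_mono) simp
    then show "(norm (grad F (X \<omega>) - grad F 0))\<^sup>2 \<le> \<rho>\<^sup>2 * (norm (X \<omega>))\<^sup>2"
      by (simp add: power_mult_distrib)
  qed measurable
  from square_integrable_add[OF this square_integrable_const[of "grad F 0"]]
  show ?thesis by simp
qed

text \<open>
  Smoothness bounds \<open>F\<close> above by a quadratic, whose expectation at \<open>X\<close> is finite.
\<close>

lemma (in finite_measure) integrable_smooth_bounded_below: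
  fixes F :: "real ^ 'n \<Rightarrow> real"
  assumes F: "smooth_with \<rho> F" and c: "\<And>y. c \<le> F y" and X: "square_integrable M X"
  shows "integrable M (\<lambda>\<omega>. F (X \<omega>))"
proof (rule Bochner_Integration.integrable_bound)
  have [measurable]: "F \<in> borel_measurable borel"
    using smooth_with_continuous[OF F] by (rule borel_measurable_continuous_onI)
  note [measurable] = square_integrable_measurable[OF X]
  show "(\<lambda>\<omega>. F (X \<omega>)) \<in> borel_measurable M" by measurable
  let ?b = "\<lambda>\<omega>. \<bar>c\<bar> + \<bar>F 0\<bar> + \<bar>X \<omega> \<bullet> grad F 0\<bar> + \<bar>\<rho> / 2\<bar> * (norm (X \<omega>))\<^sup>2"
  show "integrable M ?b"
    using square_integrable_inner[OF X square_integrable_const[of "grad F 0"]]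
      square_integrable_integrable[OF X] by auto
  have "\<bar>F (X \<omega>)\<bar> \<le> ?b \<omega>" for \<omega>
  proof -
    have "F (X \<omega>) \<le> F 0 + X \<omega> \<bullet> grad F 0 + \<rho> / 2 * (norm (X \<omega>))\<^sup>2"
      using smooth_with_descent[OF F, of 0 "X \<omega>"] by simp
    moreover have "\<rho> / 2 * (norm (X \<omega>))\<^sup>2 \<le> \<bar>\<rho> / 2\<bar> * (norm (X \<omega>))\<^sup>2"
      by (intro mult_right_mono) auto
    moreover have "0 \<le> \<bar>\<rho> / 2\<bar> * (norm (X \<omega>))\<^sup>2" by simp
    ultimately show ?thesis using c[of "X \<omega>"] by linarith
  qed
  then show "AE \<omega> in M. norm (F (X \<omega>)) \<le> norm (?b \<omega>)"
    by (intro AE_I2) (smt (verit) real_norm_def)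
qed

section \<open>Inertial descent with delayed unbiased gradients\<close>

text \<open>
  The probabilistic content of the method with a constant step, stated for an abstract filtration
  \<open>past\<close>: the noise of step \<open>k\<close> has conditional mean zero given \<open>past k\<close> and bounded second moment.
  The parameter \<open>\<eta>\<close> is the step of the recursion divided by \<open>1 - \<beta>\<close>, which is the total weight that
  a single gradient eventually acquires through the momentum term.
\<close>

locale delayed_inertial_process = prob_space M for M :: "'w measure" +
  fixes F :: "real ^ 'n \<Rightarrow> real"
    and past :: "nat \<Rightarrow> 'w measure"
    and x g :: "nat \<Rightarrow> 'w \<Rightarrow> real ^ 'n" and x0 :: "real ^ 'n"
    and delay :: "nat \<Rightarrow> nat" and \<tau> K :: nat and \<eta> \<beta> \<rho> \<sigma> :: real
  assumes F_smooth: "smooth_with \<rho> F"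
    and rho_pos: "0 < \<rho>" and eta_pos: "0 < \<eta>" and beta: "0 < \<beta>" "\<beta> < 1"
    and past_subalgebra: "\<And>k. subalgebra M (past k)"
    and past_mono: "\<And>j k. j \<le> k \<Longrightarrow> subalgebra (past k) (past j)"
    and x_adapted: "\<And>k. k \<le> K \<Longrightarrow> x k \<in> borel_measurable (past k)"
    and g_adapted: "\<And>k. k \<in> {1..K} \<Longrightarrow> g k \<in> borel_measurable (past (Suc k))"
    and unbiased: "\<And>k i. k \<in> {1..K} \<Longrightarrow>
      AE \<omega> in M. real_cond_exp M (past k) (\<lambda>\<omega>. g k \<omega> $ i) \<omega> = grad F (x (k - delay k) \<omega>) $ i"
    and noise_variance: "\<And>k. k \<in> {1..K} \<Longrightarrow>
      (\<integral>\<^sup>+\<omega>. ennreal ((norm (g k \<omega> - grad F (x (k - delay k) \<omega>)))\<^sup>2) \<partial>M) \<le> ennreal (\<sigma>\<^sup>2)"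
    and delay_bounded: "\<And>k. k \<in> {1..K} \<Longrightarrow> delay k \<le> \<tau>"
    and x_init: "\<And>\<omega>. \<omega> \<in> space M \<Longrightarrow> x 0 \<omega> = x0" "\<And>\<omega>. \<omega> \<in> space M \<Longrightarrow> x 1 \<omega> = x0"
    and x_step: "\<And>k \<omega>. k \<in> {1..K} \<Longrightarrow> \<omega> \<in> space M \<Longrightarrow>
      x (Suc k) \<omega> = x k \<omega> - ((1 - \<beta>) * \<eta>) *\<^sub>R g k \<omega> + \<beta> *\<^sub>R (x k \<omega> - x (k - 1) \<omega>)"
begin

definition stale :: "nat \<Rightarrow> 'w \<Rightarrow> real ^ 'n" where
  "stale k \<omega> = grad F (x (k - delay k) \<omega>)"

definition noise :: "nat \<Rightarrow> 'w \<Rightarrow> real ^ 'n" where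
  "noise k \<omega> = g k \<omega> - stale k \<omega>"

text \<open>
  Plain gradient descent with the same gradients and step \<open>\<eta>\<close>.  It is where \<open>x\<close> would converge if all
  later gradients were zero, so it has no momentum term and the descent lemma applies to it directly.
\<close>

definition virtual :: "nat \<Rightarrow> 'w \<Rightarrow> real ^ 'n" where
  "virtual k \<omega> = x0 - \<eta> *\<^sub>R (\<Sum>j\<in>{1..<k}. g j \<omega>)"

text \<open>
  Up to the factor \<open>- \<eta>\<close>, this is the displacement from \<open>x (k - d)\<close> to \<open>virtual k\<close>: gradients
  sampled from step \<open>k - d\<close> on count fully, earlier ones only by what the momentum has not yet delivered.
\<close>

definition lagged_sum :: "nat \<Rightarrow> nat \<Rightarrow> 'w \<Rightarrow> real ^ 'n" where
  "lagged_sum d k \<omega> = (\<Sum>j\<in>{1..<k}. \<beta> ^ (k - j - d) *\<^sub>R g j \<omega>)"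

lemma past_measurable_mono:
  assumes "j \<le> k" "Y \<in> borel_measurable (past j)"
  shows "Y \<in> borel_measurable (past k)"
  using measurable_from_subalg[OF past_mono] assms by blast

lemma past_measurable:
  "Y \<in> borel_measurable (past k) \<Longrightarrow> Y \<in> borel_measurable M"
  using measurable_from_subalg[OF past_subalgebra] by blast

lemma grad_F_measurable [measurable]: "grad F \<in> borel_measurable borel"
  using F_smooth by (rule smooth_with_grad_measurable)

lemma stale_adapted:
  assumes "k \<in> {1..K}" shows "stale k \<in> borel_measurable (past k)"
proof -
  have [measurable]: "x (k - delay k) \<in> borel_measurable (past k)"
    using x_adapted[of "k - delay k"] assms by (intro past_measurable_mono[of "k - delay k" k]) auto
  show ?thesis unfolding stale_def[abs_def] by measurable
qed

lemma noise_adapted: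
  assumes "k \<in> {1..K}" shows "noise k \<in> borel_measurable (past (Suc k))"
proof -
  have [measurable]: "stale k \<in> borel_measurable (past (Suc k))"
    using stale_adapted[OF assms] by (intro past_measurable_mono[of k "Suc k"]) auto
  note [measurable] = g_adapted[OF assms]
  show ?thesis unfolding noise_def[abs_def] by measurable
qed

lemma virtual_adapted:
  assumes "k \<le> Suc K" shows "virtual k \<in> borel_measurable (past k)"
  unfolding virtual_def[abs_def]
proof (intro borel_measurable_diff borel_measurable_scaleR borel_measurable_sum borel_measurable_const)
  fix j assume "j \<in> {1..<k}"
  then show "g j \<in> borel_measurable (past k)"
    using assms g_adapted[of j] by (intro past_measurable_mono[of "Suc j" k]) auto
qed

lemma noise_square_integrable:
  assumes k: "k \<in> {1..K}"
  shows "square_integrable M (noise k)" and "expectation (\<lambda>\<omega>. (norm (noise k \<omega>))\<^sup>2) \<le> \<sigma>\<^sup>2"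
  using square_integrable_if_nn_integral_le[of "noise k" M "\<sigma>\<^sup>2"] noise_variance[OF k]
    past_measurable[OF noise_adapted[OF k]]
  by (auto simp: noise_def stale_def)

text \<open>
  The noise is square integrable by assumption and the gradient of a smooth function grows at most
  linearly, so square integrability propagates along the recursion.
\<close>

lemma x_square_integrable: "k \<le> Suc K \<Longrightarrow> square_integrable M (x k)"
proof (induction k rule: less_induct)
  case (less k)
  consider "k = 0" | "k = 1" | m where "k = Suc m" "m \<in> {1..K}"
    using less.prems by (cases k) (auto simp: Suc_le_eq not_less)
  then show ?case
  proof cases
    case 1
    then show ?thesis
      using square_integrable_cong[of M "x 0" "\<lambda>_. x0"] x_init square_integrable_const by blast
  next
    case 2
    then show ?thesis
      using square_integrable_cong[of M "x 1" "\<lambda>_. x0"] x_init square_integrable_const by blast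
  next
    case (3 m)
    have sx: "square_integrable M (x m)" "square_integrable M (x (m - 1))"
      "square_integrable M (x (m - delay m))"
      using 3 less by auto
    have "square_integrable M (\<lambda>\<omega>. noise m \<omega> + grad F (x (m - delay m) \<omega>))"
      using noise_square_integrable(1)[OF 3(2)] sx(3)
      by (intro square_integrable_add square_integrable_grad[OF F_smooth]) auto
    then have "square_integrable M (g m)"
      by (simp add: noise_def stale_def)
    with sx have "square_integrable M (\<lambda>\<omega>. x m \<omega> - ((1 - \<beta>) * \<eta>) *\<^sub>R g m \<omega> + \<beta> *\<^sub>R (x m \<omega> - x (m - 1) \<omega>))"
      by (intro square_integrable_add square_integrable_diff square_integrable_scaleR) auto
    moreover have "square_integrable M (x k) \<longleftrightarrow> square_integrable M
        (\<lambda>\<omega>. x m \<omega> - ((1 - \<beta>) * \<eta>) *\<^sub>R g m \<omega> + \<beta> *\<^sub>R (x m \<omega> - x (m - 1) \<omega>))"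
      unfolding 3(1) by (rule square_integrable_cong) (rule x_step[OF 3(2)])
    ultimately show ?thesis by simp
  qed
qed

lemma stale_square_integrable: "k \<in> {1..K} \<Longrightarrow> square_integrable M (stale k)"
  unfolding stale_def[abs_def] by (intro square_integrable_grad[OF F_smooth] x_square_integrable) auto

lemma g_square_integrable:
  assumes "k \<in> {1..K}" shows "square_integrable M (g k)"
  using square_integrable_add[OF noise_square_integrable(1)[OF assms] stale_square_integrable[OF assms]]
  by (simp add: noise_def)

lemma virtual_square_integrable: "k \<le> Suc K \<Longrightarrow> square_integrable M (virtual k)"
  unfolding virtual_def[abs_def]
  by (intro square_integrable_diff square_integrable_const square_integrable_scaleR
      square_integrable_sum g_square_integrable) auto

text \<open>
  Coordinatewise, conditional unbiasedness allows the sampled gradient to be replaced by the stale one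
  inside an expectation against any factor that is known before step \<open>k\<close>.
\<close>

lemma noise_orthogonal_past:
  assumes k: "k \<in> {1..K}" and Y: "Y \<in> borel_measurable (past k)" and Y2: "square_integrable M Y"
  shows "expectation (\<lambda>\<omega>. Y \<omega> \<bullet> noise k \<omega>) = 0"
proof -
  interpret sub: finite_measure_subalgebra M "past k"
    by standard (fact past_subalgebra)
  note [measurable] = square_integrable_measurable[OF g_square_integrable[OF k]]
    square_integrable_measurable[OF Y2] square_integrable_measurable[OF stale_square_integrable[OF k]]
  have coord: "integrable M (\<lambda>\<omega>. Y \<omega> $ i * Z \<omega> $ i)" if "square_integrable M Z"
    for i and Z :: "'w \<Rightarrow> real ^ 'n"
    using square_integrable_inner[OF square_integrable_component[OF Y2, of i] square_integrable_component[OF that, of i]]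
    by (simp add: inner_real_def)
  have eq: "expectation (\<lambda>\<omega>. Y \<omega> $ i * g k \<omega> $ i) = expectation (\<lambda>\<omega>. Y \<omega> $ i * stale k \<omega> $ i)" for i
  proof -
    have "expectation (\<lambda>\<omega>. Y \<omega> $ i * g k \<omega> $ i)
        = expectation (\<lambda>\<omega>. Y \<omega> $ i * real_cond_exp M (past k) (\<lambda>\<omega>. g k \<omega> $ i) \<omega>)"
      using coord[OF g_square_integrable[OF k]] Y
      by (intro sub.real_cond_exp_intg(2)[symmetric] borel_measurable_vec_component) auto
    also have "\<dots> = expectation (\<lambda>\<omega>. Y \<omega> $ i * stale k \<omega> $ i)"
    proof (rule integral_cong_AE)
      show "AE \<omega> in M. Y \<omega> $ i * real_cond_exp M (past k) (\<lambda>\<omega>. g k \<omega> $ i) \<omega> = Y \<omega> $ i * stale k \<omega> $ i"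
        using unbiased[OF k, of i] by (auto simp: stale_def)
      show "(\<lambda>\<omega>. Y \<omega> $ i * stale k \<omega> $ i) \<in> borel_measurable M"
        by (intro borel_measurable_times borel_measurable_vec_component) auto
      show "(\<lambda>\<omega>. Y \<omega> $ i * real_cond_exp M (past k) (\<lambda>\<omega>. g k \<omega> $ i) \<omega>) \<in> borel_measurable M"
        by (intro borel_measurable_times borel_measurable_vec_component borel_measurable_cond_exp2) auto
    qed
    finally show ?thesis .
  qed
  have "expectation (\<lambda>\<omega>. Y \<omega> \<bullet> noise k \<omega>)
      = expectation (\<lambda>\<omega>. \<Sum>i\<in>UNIV. Y \<omega> $ i * g k \<omega> $ i - Y \<omega> $ i * stale k \<omega> $ i)"
    by (simp add: noise_def inner_vec_def inner_real_def right_diff_distrib)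
  also have "\<dots> = (\<Sum>i\<in>UNIV. expectation (\<lambda>\<omega>. Y \<omega> $ i * g k \<omega> $ i) - expectation (\<lambda>\<omega>. Y \<omega> $ i * stale k \<omega> $ i))"
    using coord[OF g_square_integrable[OF k]] coord[OF stale_square_integrable[OF k]]
    by (subst Bochner_Integration.integral_sum) (auto intro!: sum.cong Bochner_Integration.integral_diff)
  finally show ?thesis by (simp add: eq)
qed

lemma noise_orthogonal:
  assumes "i \<in> {1..K}" "j \<in> {1..K}" "i \<noteq> j"
  shows "expectation (\<lambda>\<omega>. noise i \<omega> \<bullet> noise j \<omega>) = 0"
proof -
  have "expectation (\<lambda>\<omega>. noise i \<omega> \<bullet> noise j \<omega>) = 0" if "i \<in> {1..K}" "j \<in> {1..K}" "i < j" for i j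
    using that
    by (intro noise_orthogonal_past past_measurable_mono[OF _ noise_adapted[of i]] noise_square_integrable) auto
  from this[of i j] this[of j i] assms show ?thesis
    by (cases "i < j") (auto simp: inner_commute)
qed

text \<open>
  Noise vectors of different steps are orthogonal, so weights enter through their squares.  This is
  what keeps the delay contribution to the noise linear in \<open>\<tau>\<close>.
\<close>

lemma weighted_noise_bound:
  assumes I: "I \<subseteq> {1..K}"
  shows "expectation (\<lambda>\<omega>. (norm (\<Sum>j\<in>I. w j *\<^sub>R noise j \<omega>))\<^sup>2) \<le> \<sigma>\<^sup>2 * (\<Sum>j\<in>I. (w j)\<^sup>2)"
proof -
  have fin: "finite I" using I finite_subset by blast
  have int: "integrable M (\<lambda>\<omega>. w i * (w j * (noise i \<omega> \<bullet> noise j \<omega>)))" if "i \<in> I" "j \<in> I" for i j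
    using that I by (intro integrable_mult_right square_integrable_inner noise_square_integrable) auto
  have "expectation (\<lambda>\<omega>. (norm (\<Sum>j\<in>I. w j *\<^sub>R noise j \<omega>))\<^sup>2)
      = expectation (\<lambda>\<omega>. \<Sum>i\<in>I. \<Sum>j\<in>I. w i * (w j * (noise i \<omega> \<bullet> noise j \<omega>)))"
    by (simp add: power2_norm_eq_inner inner_sum_left inner_sum_right sum_distrib_left inner_commute mult_ac)
  also have "\<dots> = (\<Sum>i\<in>I. \<Sum>j\<in>I. w i * (w j * expectation (\<lambda>\<omega>. noise i \<omega> \<bullet> noise j \<omega>)))"
    using int by (simp add: Bochner_Integration.integral_sum Bochner_Integration.integrable_sum)
  also have "\<dots> = (\<Sum>i\<in>I. \<Sum>j\<in>I. if j = i then (w i)\<^sup>2 * expectation (\<lambda>\<omega>. (norm (noise i \<omega>))\<^sup>2) else 0)"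
  proof (intro sum.cong refl)
    fix i j assume "i \<in> I" "j \<in> I"
    then have "i \<in> {1..K}" "j \<in> {1..K}" using I by auto
    then show "w i * (w j * expectation (\<lambda>\<omega>. noise i \<omega> \<bullet> noise j \<omega>))
        = (if j = i then (w i)\<^sup>2 * expectation (\<lambda>\<omega>. (norm (noise i \<omega>))\<^sup>2) else 0)"
      using noise_orthogonal[of i j] by (auto simp: power2_norm_eq_inner power2_eq_square[of "w _"])
  qed
  also have "\<dots> = (\<Sum>i\<in>I. (w i)\<^sup>2 * expectation (\<lambda>\<omega>. (norm (noise i \<omega>))\<^sup>2))"
    using fin by simp
  also have "\<dots> \<le> (\<Sum>i\<in>I. (w i)\<^sup>2 * \<sigma>\<^sup>2)"
    using I noise_square_integrable(2) by (intro sum_mono mult_left_mono) auto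
  finally show ?thesis by (simp add: sum_distrib_left mult.commute)
qed

lemma virtual_minus_lagged:
  assumes k: "k \<in> {1..K}" and \<omega>: "\<omega> \<in> space M"
  shows "virtual k \<omega> - x (k - d) \<omega> = - \<eta> *\<^sub>R lagged_sum d k \<omega>"
proof -
  have "x (k - d) \<omega> = x0 - \<eta> *\<^sub>R (\<Sum>j\<in>{1..<k}. (1 - \<beta> ^ (k - j - d)) *\<^sub>R g j \<omega>)"
  proof (cases "k - d")
    \<comment> \<open>All gradients so far lie within the delay and have weight \<open>1\<close>; \<open>x 0\<close> is the starting point.\<close>
    case 0
    then have "k - j - d = 0" for j by simp
    with 0 show ?thesis using x_init \<omega> by simp
  next
    case (Suc m)
    have "x (Suc m) \<omega> = x 1 \<omega> - \<eta> *\<^sub>R (\<Sum>j\<in>{1..m}. (1 - \<beta> ^ (Suc m - j)) *\<^sub>R g j \<omega>)"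
      using Suc k x_init \<omega> x_step[OF _ \<omega>]
      by (intro inertial_closed_form[where x = "\<lambda>k. x k \<omega>" and g = "\<lambda>k. g k \<omega>" and K = K]) auto
    also have "(\<Sum>j\<in>{1..m}. (1 - \<beta> ^ (Suc m - j)) *\<^sub>R g j \<omega>)
        = (\<Sum>j\<in>{1..<k}. (1 - \<beta> ^ (k - j - d)) *\<^sub>R g j \<omega>)"
    proof (rule sum.mono_neutral_cong_left)
      have "k - j - d = Suc m - j" for j using Suc by linarith
      then show "(1 - \<beta> ^ (Suc m - j)) *\<^sub>R g j \<omega> = (1 - \<beta> ^ (k - j - d)) *\<^sub>R g j \<omega>" for j by simp
      show "\<forall>j\<in>{1..<k} - {1..m}. (1 - \<beta> ^ (k - j - d)) *\<^sub>R g j \<omega> = 0"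
      proof
        fix j assume "j \<in> {1..<k} - {1..m}"
        then have "k - j - d = 0" using Suc by auto
        then show "(1 - \<beta> ^ (k - j - d)) *\<^sub>R g j \<omega> = 0" by simp
      qed
    qed (use Suc in auto)
    finally show ?thesis using Suc x_init \<omega> by simp
  qed
  then show ?thesis
    by (simp add: virtual_def lagged_sum_def scaleR_left_diff_distrib sum_subtractf scaleR_right_diff_distrib)
qed


text \<open>
  Each gradient is split into noise and stale gradient.  Orthogonality bounds the noise and
  Cauchy-Schwarz with the weights bounds the rest.  The two cannot be separated exactly, because a stale
  gradient depends on earlier noise.  The weights are enlarged from \<open>d\<close> to a common
  bound \<open>D\<close> so that the result can be summed over steps with different delays.
\<close>

lemma lagged_gradient_sum_bound:
  assumes k: "k \<in> {1..K}" and d: "d \<le> D"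
  shows "expectation (\<lambda>\<omega>. (norm (lagged_sum d k \<omega>))\<^sup>2)
    \<le> 7 / 3 * (\<sigma>\<^sup>2 * (real D + \<beta>\<^sup>2 / (1 - \<beta>\<^sup>2)))
      + 7 / 4 * ((real D + \<beta> / (1 - \<beta>)) *
          (\<Sum>j\<in>{1..<k}. \<beta> ^ (k - j - D) * expectation (\<lambda>\<omega>. (norm (stale j \<omega>))\<^sup>2)))"
proof -
  let ?I = "{1..<k}"
  let ?w = "\<lambda>j. \<beta> ^ (k - j - d)" and ?W = "\<lambda>j. \<beta> ^ (k - j - D)"
  have I: "?I \<subseteq> {1..K}" using k by auto
  have w: "0 \<le> ?w j" "?w j \<le> ?W j" for j
    using beta d by (auto intro!: power_decreasing)
  have reindex: "(\<Sum>j\<in>?I. b ^ (k - j - e)) = (\<Sum>i\<in>{1..k - 1}. b ^ (i - e))" for b :: real and e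
    by (rule sum.reindex_bij_witness[of _ "\<lambda>i. k - i" "\<lambda>j. k - j"]) auto
  have sumW: "(\<Sum>j\<in>?I. ?W j) \<le> real D + \<beta> / (1 - \<beta>)"
    unfolding reindex using beta by (intro sum_truncated_power_le) auto
  have sumw: "(\<Sum>j\<in>?I. ?w j) \<le> real D + \<beta> / (1 - \<beta>)"
    using sum_mono[of ?I ?w ?W] w(2) sumW by fastforce
  have "\<beta>\<^sup>2 < 1" using beta by (simp add: power_less_one_iff)
  have "(\<Sum>j\<in>?I. (?w j)\<^sup>2) \<le> (\<Sum>j\<in>?I. (?W j)\<^sup>2)"
    using w by (intro sum_mono power_mono) auto
  also have "\<dots> = (\<Sum>j\<in>?I. (\<beta>\<^sup>2) ^ (k - j - D))"
    by (simp add: power_mult[symmetric] mult.commute)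
  also have "\<dots> \<le> real D + \<beta>\<^sup>2 / (1 - \<beta>\<^sup>2)"
    unfolding reindex using \<open>\<beta>\<^sup>2 < 1\<close> by (intro sum_truncated_power_le) auto
  finally have sumw2: "(\<Sum>j\<in>?I. (?w j)\<^sup>2) \<le> real D + \<beta>\<^sup>2 / (1 - \<beta>\<^sup>2)" .
  have int_noise: "integrable M (\<lambda>\<omega>. (norm (\<Sum>j\<in>?I. ?w j *\<^sub>R noise j \<omega>))\<^sup>2)"
    using I by (intro square_integrable_integrable square_integrable_sum square_integrable_scaleR
        noise_square_integrable) auto
  have int_stale: "integrable M (\<lambda>\<omega>. \<Sum>j\<in>?I. ?W j * (norm (stale j \<omega>))\<^sup>2)"
    using I by (intro Bochner_Integration.integrable_sum integrable_mult_right
        square_integrable_integrable stale_square_integrable) auto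
  have "expectation (\<lambda>\<omega>. (norm (\<Sum>j\<in>?I. ?w j *\<^sub>R g j \<omega>))\<^sup>2)
      \<le> expectation (\<lambda>\<omega>. 7 / 3 * (norm (\<Sum>j\<in>?I. ?w j *\<^sub>R noise j \<omega>))\<^sup>2
        + 7 / 4 * ((real D + \<beta> / (1 - \<beta>)) * (\<Sum>j\<in>?I. ?W j * (norm (stale j \<omega>))\<^sup>2)))"
  proof (rule integral_mono)
    show "integrable M (\<lambda>\<omega>. (norm (\<Sum>j\<in>?I. ?w j *\<^sub>R g j \<omega>))\<^sup>2)"
      using I by (intro square_integrable_integrable square_integrable_sum square_integrable_scaleR
          g_square_integrable) auto
    show "integrable M (\<lambda>\<omega>. 7 / 3 * (norm (\<Sum>j\<in>?I. ?w j *\<^sub>R noise j \<omega>))\<^sup>2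
        + 7 / 4 * ((real D + \<beta> / (1 - \<beta>)) * (\<Sum>j\<in>?I. ?W j * (norm (stale j \<omega>))\<^sup>2)))"
      by (intro Bochner_Integration.integrable_add integrable_mult_right int_noise int_stale)
    fix \<omega>
    have split: "(\<Sum>j\<in>?I. ?w j *\<^sub>R g j \<omega>) = (\<Sum>j\<in>?I. ?w j *\<^sub>R noise j \<omega>) + (\<Sum>j\<in>?I. ?w j *\<^sub>R stale j \<omega>)"
      by (simp add: noise_def scaleR_right_diff_distrib sum_subtractf)
    have "(norm (\<Sum>j\<in>?I. ?w j *\<^sub>R g j \<omega>))\<^sup>2
        \<le> 7 / 3 * (norm (\<Sum>j\<in>?I. ?w j *\<^sub>R noise j \<omega>))\<^sup>2 + 7 / 4 * (norm (\<Sum>j\<in>?I. ?w j *\<^sub>R stale j \<omega>))\<^sup>2"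
      unfolding split by (rule norm_add_square_le)
    moreover have "(norm (\<Sum>j\<in>?I. ?w j *\<^sub>R stale j \<omega>))\<^sup>2
        \<le> (\<Sum>j\<in>?I. ?w j) * (\<Sum>j\<in>?I. ?w j * (norm (stale j \<omega>))\<^sup>2)"
      using w(1) by (rule weighted_sum_norm_square_le)
    moreover have "(\<Sum>j\<in>?I. ?w j) * (\<Sum>j\<in>?I. ?w j * (norm (stale j \<omega>))\<^sup>2)
        \<le> (real D + \<beta> / (1 - \<beta>)) * (\<Sum>j\<in>?I. ?W j * (norm (stale j \<omega>))\<^sup>2)"
      using sumw w beta by (intro mult_mono sum_mono mult_right_mono sum_nonneg) auto
    ultimately show "(norm (\<Sum>j\<in>?I. ?w j *\<^sub>R g j \<omega>))\<^sup>2
        \<le> 7 / 3 * (norm (\<Sum>j\<in>?I. ?w j *\<^sub>R noise j \<omega>))\<^sup>2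
          + 7 / 4 * ((real D + \<beta> / (1 - \<beta>)) * (\<Sum>j\<in>?I. ?W j * (norm (stale j \<omega>))\<^sup>2))"
      by linarith
  qed
  also have "\<dots> = 7 / 3 * expectation (\<lambda>\<omega>. (norm (\<Sum>j\<in>?I. ?w j *\<^sub>R noise j \<omega>))\<^sup>2)
      + 7 / 4 * ((real D + \<beta> / (1 - \<beta>)) *
          expectation (\<lambda>\<omega>. \<Sum>j\<in>?I. ?W j * (norm (stale j \<omega>))\<^sup>2))"
    using int_noise int_stale by (subst Bochner_Integration.integral_add) auto
  also have "expectation (\<lambda>\<omega>. \<Sum>j\<in>?I. ?W j * (norm (stale j \<omega>))\<^sup>2)
      = (\<Sum>j\<in>?I. ?W j * expectation (\<lambda>\<omega>. (norm (stale j \<omega>))\<^sup>2))"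
    using k by (subst Bochner_Integration.integral_sum)
      (auto intro!: integrable_mult_right square_integrable_integrable stale_square_integrable)
  also have "expectation (\<lambda>\<omega>. (norm (\<Sum>j\<in>?I. ?w j *\<^sub>R noise j \<omega>))\<^sup>2)
      \<le> \<sigma>\<^sup>2 * (real D + \<beta>\<^sup>2 / (1 - \<beta>\<^sup>2))"
    using weighted_noise_bound[OF I, of ?w] mult_left_mono[OF sumw2, of "\<sigma>\<^sup>2"] by simp
  finally show ?thesis by (simp add: lagged_sum_def)
qed

lemma lagged_sum_square_integrable:
  "k \<in> {1..K} \<Longrightarrow> square_integrable M (lagged_sum d k)"
  unfolding lagged_sum_def[abs_def]
  by (intro square_integrable_sum square_integrable_scaleR g_square_integrable) auto

lemma grad_virtual_minus_lagged:
  assumes "k \<in> {1..K}" "\<omega> \<in> space M"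
  shows "(norm (grad F (virtual k \<omega>) - grad F (x (k - d) \<omega>)))\<^sup>2
    \<le> \<rho>\<^sup>2 * \<eta>\<^sup>2 * (norm (lagged_sum d k \<omega>))\<^sup>2"
proof -
  have "norm (grad F (virtual k \<omega>) - grad F (x (k - d) \<omega>)) \<le> \<rho> * norm (virtual k \<omega> - x (k - d) \<omega>)"
    using F_smooth by (auto simp: smooth_with_def)
  also have "\<dots> = \<rho> * \<eta> * norm (lagged_sum d k \<omega>)"
    unfolding virtual_minus_lagged[OF assms] using eta_pos by simp
  finally have "(norm (grad F (virtual k \<omega>) - grad F (x (k - d) \<omega>)))\<^sup>2
      \<le> (\<rho> * \<eta> * norm (lagged_sum d k \<omega>))\<^sup>2"
    by (intro power_mono) auto
  then show ?thesis by (simp add: power_mult_distrib)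
qed

text \<open>
  One descent step for the auxiliary sequence.  The gradient that drives the step is compared with the
  gradient at the auxiliary point, which in turn is compared with the one at the current iterate; both
  distances are lagged sums, for the delay \<open>delay k\<close> and for the delay \<open>0\<close> respectively.
\<close>

lemma pointwise_descent:
  assumes k: "k \<in> {1..K}" and \<omega>: "\<omega> \<in> space M"
  shows "F (virtual (Suc k) \<omega>) + \<eta> / 4 * (norm (grad F (x k \<omega>)))\<^sup>2
    \<le> F (virtual k \<omega>)
      + \<eta> / 2 * (\<rho>\<^sup>2 * \<eta>\<^sup>2 * (norm (lagged_sum 0 k \<omega>))\<^sup>2)
      + \<eta> / 2 * (\<rho>\<^sup>2 * \<eta>\<^sup>2 * (norm (lagged_sum (delay k) k \<omega>))\<^sup>2)
      - \<eta> / 2 * (norm (stale k \<omega>))\<^sup>2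
      - \<eta> * (grad F (virtual k \<omega>) \<bullet> noise k \<omega>)
      + \<rho> / 2 * \<eta>\<^sup>2 * ((norm (stale k \<omega>))\<^sup>2 + 2 * (stale k \<omega> \<bullet> noise k \<omega>) + (norm (noise k \<omega>))\<^sup>2)"
proof -
  let ?u = "grad F (virtual k \<omega>)"
  have gk: "g k \<omega> = stale k \<omega> + noise k \<omega>" by (simp add: noise_def)
  have "{1..<Suc k} = insert k {1..<k}" using k by auto
  then have v: "virtual (Suc k) \<omega> = virtual k \<omega> + (- \<eta> *\<^sub>R g k \<omega>)"
    by (simp add: virtual_def scaleR_right_distrib)
  have "F (virtual (Suc k) \<omega>) \<le> F (virtual k \<omega>) + (- \<eta> *\<^sub>R g k \<omega>) \<bullet> ?u + \<rho> / 2 * (norm (- \<eta> *\<^sub>R g k \<omega>))\<^sup>2"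
    unfolding v by (rule smooth_with_descent[OF F_smooth])
  also have "(- \<eta> *\<^sub>R g k \<omega>) \<bullet> ?u = \<eta> * (- (?u \<bullet> stale k \<omega>)) - \<eta> * (?u \<bullet> noise k \<omega>)"
    by (simp add: gk inner_add_right inner_commute algebra_simps)
  also have "\<rho> / 2 * (norm (- \<eta> *\<^sub>R g k \<omega>))\<^sup>2
      = \<rho> / 2 * \<eta>\<^sup>2 * ((norm (stale k \<omega>))\<^sup>2 + 2 * (stale k \<omega> \<bullet> noise k \<omega>) + (norm (noise k \<omega>))\<^sup>2)"
    by (simp add: gk power_mult_distrib power2_norm_eq_inner inner_add_left inner_add_right inner_commute)
  finally have descent: "F (virtual (Suc k) \<omega>)
      \<le> F (virtual k \<omega>) + (\<eta> * (- (?u \<bullet> stale k \<omega>)) - \<eta> * (?u \<bullet> noise k \<omega>))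
      + \<rho> / 2 * \<eta>\<^sup>2 * ((norm (stale k \<omega>))\<^sup>2 + 2 * (stale k \<omega> \<bullet> noise k \<omega>) + (norm (noise k \<omega>))\<^sup>2)" .
  have "- (?u \<bullet> stale k \<omega>) \<le> - (norm (grad F (x k \<omega>)))\<^sup>2 / 4
      + (\<rho>\<^sup>2 * \<eta>\<^sup>2 * (norm (lagged_sum 0 k \<omega>))\<^sup>2) / 2 - (norm (stale k \<omega>))\<^sup>2 / 2
      + (\<rho>\<^sup>2 * \<eta>\<^sup>2 * (norm (lagged_sum (delay k) k \<omega>))\<^sup>2) / 2"
    using gradient_product_bound[of ?u "stale k \<omega>" "grad F (x k \<omega>)"]
      grad_virtual_minus_lagged[OF k \<omega>, of 0] grad_virtual_minus_lagged[OF k \<omega>, of "delay k"]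
    by (simp add: stale_def)
  then have "\<eta> * (- (?u \<bullet> stale k \<omega>)) \<le> \<eta> * (- (norm (grad F (x k \<omega>)))\<^sup>2 / 4
      + (\<rho>\<^sup>2 * \<eta>\<^sup>2 * (norm (lagged_sum 0 k \<omega>))\<^sup>2) / 2 - (norm (stale k \<omega>))\<^sup>2 / 2
      + (\<rho>\<^sup>2 * \<eta>\<^sup>2 * (norm (lagged_sum (delay k) k \<omega>))\<^sup>2) / 2)"
    using eta_pos by (intro mult_left_mono) auto
  also have "\<dots> = - \<eta> / 4 * (norm (grad F (x k \<omega>)))\<^sup>2
      + \<eta> / 2 * (\<rho>\<^sup>2 * \<eta>\<^sup>2 * (norm (lagged_sum 0 k \<omega>))\<^sup>2) - \<eta> / 2 * (norm (stale k \<omega>))\<^sup>2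
      + \<eta> / 2 * (\<rho>\<^sup>2 * \<eta>\<^sup>2 * (norm (lagged_sum (delay k) k \<omega>))\<^sup>2)"
    by (simp add: field_simps)
  finally show ?thesis using descent by simp
qed

text \<open>
  The terms linear in the noise vanish: the auxiliary point and the stale gradient belong to the past.
\<close>

lemma expected_descent:
  assumes k: "k \<in> {1..K}" and c: "\<And>y. c \<le> F y"
  shows "expectation (\<lambda>\<omega>. F (virtual (Suc k) \<omega>)) + \<eta> / 4 * expectation (\<lambda>\<omega>. (norm (grad F (x k \<omega>)))\<^sup>2)
    \<le> expectation (\<lambda>\<omega>. F (virtual k \<omega>))
      + \<eta> / 2 * (\<rho>\<^sup>2 * \<eta>\<^sup>2 * expectation (\<lambda>\<omega>. (norm (lagged_sum 0 k \<omega>))\<^sup>2))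
      + \<eta> / 2 * (\<rho>\<^sup>2 * \<eta>\<^sup>2 * expectation (\<lambda>\<omega>. (norm (lagged_sum (delay k) k \<omega>))\<^sup>2))
      - \<eta> / 2 * expectation (\<lambda>\<omega>. (norm (stale k \<omega>))\<^sup>2)
      + \<rho> / 2 * \<eta>\<^sup>2 * (expectation (\<lambda>\<omega>. (norm (stale k \<omega>))\<^sup>2) + \<sigma>\<^sup>2)"
proof -
  have v: "square_integrable M (virtual k)" "square_integrable M (virtual (Suc k))"
    using k by (auto intro: virtual_square_integrable)
  have gv: "square_integrable M (\<lambda>\<omega>. grad F (virtual k \<omega>))"
    using v(1) by (rule square_integrable_grad[OF F_smooth])
  note [simp] = integrable_smooth_bounded_below[OF F_smooth c v(1)]
    integrable_smooth_bounded_below[OF F_smooth c v(2)]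
    square_integrable_integrable[OF lagged_sum_square_integrable[OF k]]
    square_integrable_integrable[OF stale_square_integrable[OF k]]
    square_integrable_integrable[OF noise_square_integrable(1)[OF k]]
    square_integrable_inner[OF stale_square_integrable[OF k] noise_square_integrable(1)[OF k]]
    square_integrable_inner[OF gv noise_square_integrable(1)[OF k]]
  have [simp]: "integrable M (\<lambda>\<omega>. (norm (grad F (x k \<omega>)))\<^sup>2)"
    using k by (intro square_integrable_integrable square_integrable_grad[OF F_smooth] x_square_integrable) auto
  have vm: "virtual k \<in> borel_measurable (past k)"
    using k by (intro virtual_adapted) auto
  have "(\<lambda>\<omega>. grad F (virtual k \<omega>)) \<in> borel_measurable (past k)"
    using measurable_compose[OF vm grad_F_measurable] .
  then have orth: "expectation (\<lambda>\<omega>. grad F (virtual k \<omega>) \<bullet> noise k \<omega>) = 0"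
    using k gv by (intro noise_orthogonal_past)
  have orth': "expectation (\<lambda>\<omega>. stale k \<omega> \<bullet> noise k \<omega>) = 0"
    using k by (intro noise_orthogonal_past stale_adapted stale_square_integrable)
  have "expectation (\<lambda>\<omega>. F (virtual (Suc k) \<omega>) + \<eta> / 4 * (norm (grad F (x k \<omega>)))\<^sup>2)
    \<le> expectation (\<lambda>\<omega>. F (virtual k \<omega>)
      + \<eta> / 2 * (\<rho>\<^sup>2 * \<eta>\<^sup>2 * (norm (lagged_sum 0 k \<omega>))\<^sup>2)
      + \<eta> / 2 * (\<rho>\<^sup>2 * \<eta>\<^sup>2 * (norm (lagged_sum (delay k) k \<omega>))\<^sup>2)
      - \<eta> / 2 * (norm (stale k \<omega>))\<^sup>2
      - \<eta> * (grad F (virtual k \<omega>) \<bullet> noise k \<omega>)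
      + \<rho> / 2 * \<eta>\<^sup>2 * ((norm (stale k \<omega>))\<^sup>2 + 2 * (stale k \<omega> \<bullet> noise k \<omega>) + (norm (noise k \<omega>))\<^sup>2))"
    by (intro integral_mono pointwise_descent[OF k]) auto
  also have "\<dots> = expectation (\<lambda>\<omega>. F (virtual k \<omega>))
      + \<eta> / 2 * (\<rho>\<^sup>2 * \<eta>\<^sup>2 * expectation (\<lambda>\<omega>. (norm (lagged_sum 0 k \<omega>))\<^sup>2))
      + \<eta> / 2 * (\<rho>\<^sup>2 * \<eta>\<^sup>2 * expectation (\<lambda>\<omega>. (norm (lagged_sum (delay k) k \<omega>))\<^sup>2))
      - \<eta> / 2 * expectation (\<lambda>\<omega>. (norm (stale k \<omega>))\<^sup>2)
      + \<rho> / 2 * \<eta>\<^sup>2 * (expectation (\<lambda>\<omega>. (norm (stale k \<omega>))\<^sup>2) + expectation (\<lambda>\<omega>. (norm (noise k \<omega>))\<^sup>2))"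
    using orth orth' by simp
  also have "\<rho> / 2 * \<eta>\<^sup>2 * (expectation (\<lambda>\<omega>. (norm (stale k \<omega>))\<^sup>2) + expectation (\<lambda>\<omega>. (norm (noise k \<omega>))\<^sup>2))
      \<le> \<rho> / 2 * \<eta>\<^sup>2 * (expectation (\<lambda>\<omega>. (norm (stale k \<omega>))\<^sup>2) + \<sigma>\<^sup>2)"
    using rho_pos noise_square_integrable(2)[OF k] by (intro mult_left_mono) auto
  finally show ?thesis by simp
qed

text \<open>
  Telescoping the expected descent.  The lagged sums accumulate a multiple of the total squared norm of
  the stale gradients, and the step-size conditions make this multiple at most the amount
  \<open>\<eta> / 2\<close> that each descent step subtracts, so that only noise is left.
\<close>

theorem gradient_sum_bound:
  assumes c: "\<And>y. c \<le> F y"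
    and c1: "(real \<tau>)\<^sup>2 + real \<tau> / (1 - \<beta>) + \<beta>\<^sup>2 / (1 - \<beta>\<^sup>2) \<le> 1 / (2 * \<eta>\<^sup>2 * \<rho>\<^sup>2)"
    and c2: "3 * \<rho> + 2 * (1 + 5 * \<rho>) * \<beta>\<^sup>2 / ((1 - \<beta>) * (1 - \<beta>\<^sup>2)) \<le> 1 / (2 * \<eta>)"
  shows "\<eta> / 4 * (\<Sum>k\<in>{1..K}. expectation (\<lambda>\<omega>. (norm (grad F (x k \<omega>)))\<^sup>2))
    \<le> F x0 - c + real K * (\<eta>\<^sup>2 * \<sigma>\<^sup>2 *
        (\<rho>\<^sup>2 * \<eta> * real \<tau> / 2 + (1 + 5 * \<rho>) * (\<beta>\<^sup>2 / (1 - \<beta>\<^sup>2)) / 2 + \<rho>))"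
proof -
  define Q where "Q k = expectation (\<lambda>\<omega>. (norm (grad F (x k \<omega>)))\<^sup>2)" for k
  define H where "H k = expectation (\<lambda>\<omega>. (norm (stale k \<omega>))\<^sup>2)" for k
  define \<Phi> where "\<Phi> k = expectation (\<lambda>\<omega>. F (virtual k \<omega>))" for k
  define b B where "b = \<beta> / (1 - \<beta>)" and "B = \<beta>\<^sup>2 / (1 - \<beta>\<^sup>2)"
  define S where "S D k = (\<Sum>j\<in>{1..<k}. \<beta> ^ (k - j - D) * H j)" for D k
  define A where "A = \<eta> / 2 * (\<rho>\<^sup>2 * \<eta>\<^sup>2)"
  define N where "N = A * (7 / 3 * (\<sigma>\<^sup>2 * B) + 7 / 3 * (\<sigma>\<^sup>2 * (real \<tau> + B))) + \<rho> / 2 * \<eta>\<^sup>2 * \<sigma>\<^sup>2"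
  have A: "0 \<le> A" using eta_pos by (simp add: A_def)
  have b: "0 \<le> b" using beta by (simp add: b_def)
  have B: "0 \<le> B" using beta by (simp add: B_def power_le_one)
  have H: "0 \<le> H j" for j by (simp add: H_def)
  have step: "\<eta> / 4 * Q k \<le> N - (\<Phi> (Suc k) - \<Phi> k)
      + A * (7 / 4 * (b * S 0 k) + 7 / 4 * ((real \<tau> + b) * S \<tau> k))
      - (\<eta> / 2 - \<rho> / 2 * \<eta>\<^sup>2) * H k"
    if k: "k \<in> {1..K}" for k
  proof -
    have V0: "expectation (\<lambda>\<omega>. (norm (lagged_sum 0 k \<omega>))\<^sup>2) \<le> 7 / 3 * (\<sigma>\<^sup>2 * B) + 7 / 4 * (b * S 0 k)"
      using lagged_gradient_sum_bound[OF k, of 0 0]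
      by (simp add: B_def b_def S_def H_def)
    have Vd: "expectation (\<lambda>\<omega>. (norm (lagged_sum (delay k) k \<omega>))\<^sup>2)
        \<le> 7 / 3 * (\<sigma>\<^sup>2 * (real \<tau> + B)) + 7 / 4 * ((real \<tau> + b) * S \<tau> k)"
      using lagged_gradient_sum_bound[OF k delay_bounded[OF k]]
      by (simp add: B_def b_def S_def H_def)
    have "\<Phi> (Suc k) + \<eta> / 4 * Q k \<le> \<Phi> k
      + A * expectation (\<lambda>\<omega>. (norm (lagged_sum 0 k \<omega>))\<^sup>2)
      + A * expectation (\<lambda>\<omega>. (norm (lagged_sum (delay k) k \<omega>))\<^sup>2)
      - \<eta> / 2 * H k + \<rho> / 2 * \<eta>\<^sup>2 * (H k + \<sigma>\<^sup>2)"
      using expected_descent[OF k c] by (simp add: \<Phi>_def Q_def H_def A_def mult.assoc)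
    with mult_left_mono[OF V0 A] mult_left_mono[OF Vd A] show ?thesis
      unfolding N_def by (simp add: algebra_simps add_divide_distrib)
  qed
  \<comment> \<open>Reversing the roles of the two indices costs a second factor \<open>D + b\<close>.\<close>
  have S_sum: "(\<Sum>k\<in>{1..K}. S D k) \<le> (real D + b) * (\<Sum>j\<in>{1..K}. H j)" for D
    unfolding S_def b_def using beta H by (intro lagged_double_sum_le) auto
  have telescope: "(\<Sum>k\<in>{1..K}. \<Phi> (Suc k)) - (\<Sum>k\<in>{1..K}. \<Phi> k) = \<Phi> (Suc K) - \<Phi> 1"
    using sum_Suc_diff[of 1 K \<Phi>] by (simp add: sum_subtractf)
  have "\<eta> / 4 * (\<Sum>k\<in>{1..K}. Q k) \<le> (\<Sum>k\<in>{1..K}. N - (\<Phi> (Suc k) - \<Phi> k)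
      + A * (7 / 4 * (b * S 0 k) + 7 / 4 * ((real \<tau> + b) * S \<tau> k))
      - (\<eta> / 2 - \<rho> / 2 * \<eta>\<^sup>2) * H k)"
    unfolding sum_distrib_left by (rule sum_mono) (rule step)
  also have "\<dots> = real K * N - (\<Phi> (Suc K) - \<Phi> 1)
      + A * (7 / 4 * (b * (\<Sum>k\<in>{1..K}. S 0 k)) + 7 / 4 * ((real \<tau> + b) * (\<Sum>k\<in>{1..K}. S \<tau> k)))
      - (\<eta> / 2 - \<rho> / 2 * \<eta>\<^sup>2) * (\<Sum>k\<in>{1..K}. H k)"
    by (simp only: sum_subtractf sum.distrib sum_distrib_left[symmetric] sum_constant telescope) simp
  also have "\<dots> \<le> real K * N - (\<Phi> (Suc K) - \<Phi> 1)
      + A * (7 / 4 * (b * (b * (\<Sum>k\<in>{1..K}. H k)))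
        + 7 / 4 * ((real \<tau> + b) * ((real \<tau> + b) * (\<Sum>k\<in>{1..K}. H k))))
      - (\<eta> / 2 - \<rho> / 2 * \<eta>\<^sup>2) * (\<Sum>k\<in>{1..K}. H k)"
    using S_sum[of 0] S_sum[of \<tau>] A b
    by (intro diff_right_mono add_left_mono mult_left_mono add_mono) auto
  also have "\<dots> = real K * N - (\<Phi> (Suc K) - \<Phi> 1)
      + \<eta> / 2 * (7 / 4 * (\<rho> * \<eta>)\<^sup>2 * ((real \<tau> + b)\<^sup>2 + b\<^sup>2) + \<rho> * \<eta> - 1) * (\<Sum>k\<in>{1..K}. H k)"
    unfolding A_def by (simp add: power2_eq_square field_simps)
  also have "\<dots> \<le> real K * N - (\<Phi> (Suc K) - \<Phi> 1)"
  proof -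
    have "\<eta> / 2 * (7 / 4 * (\<rho> * \<eta>)\<^sup>2 * ((real \<tau> + b)\<^sup>2 + b\<^sup>2) + \<rho> * \<eta> - 1) \<le> 0"
      using drift_coefficient_bound(1)[OF _ beta eta_pos rho_pos c1 c2] eta_pos
      unfolding b_def by (intro mult_nonneg_nonpos) auto
    then have "\<eta> / 2 * (7 / 4 * (\<rho> * \<eta>)\<^sup>2 * ((real \<tau> + b)\<^sup>2 + b\<^sup>2) + \<rho> * \<eta> - 1) * (\<Sum>k\<in>{1..K}. H k) \<le> 0"
      by (rule mult_nonpos_nonneg) (intro sum_nonneg H)
    then show ?thesis by linarith
  qed
  finally have main: "\<eta> / 4 * (\<Sum>k\<in>{1..K}. Q k) \<le> real K * N - (\<Phi> (Suc K) - \<Phi> 1)" .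
  have "N \<le> \<eta>\<^sup>2 * \<sigma>\<^sup>2 * (\<rho>\<^sup>2 * \<eta> * real \<tau> / 2 + (1 + 5 * \<rho>) * B / 2 + \<rho>)"
    using noise_coefficient_bound[OF B rho_pos, of "\<sigma>\<^sup>2" \<eta> "real \<tau>"]
      drift_coefficient_bound(2,3)[OF _ beta eta_pos rho_pos c1 c2]
    unfolding N_def A_def by (simp add: mult.assoc)
  then have N: "real K * N \<le> real K * (\<eta>\<^sup>2 * \<sigma>\<^sup>2 * (\<rho>\<^sup>2 * \<eta> * real \<tau> / 2 + (1 + 5 * \<rho>) * B / 2 + \<rho>))"
    by (rule mult_left_mono) simp
  have "\<Phi> 1 = F x0"
    by (simp add: \<Phi>_def virtual_def prob_space)
  moreover have "c \<le> \<Phi> (Suc K)"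
  proof -
    have "expectation (\<lambda>\<omega>. c) \<le> \<Phi> (Suc K)"
      unfolding \<Phi>_def using c
      by (intro integral_mono integrable_smooth_bounded_below[OF F_smooth c] virtual_square_integrable) auto
    then show ?thesis by (simp add: prob_space)
  qed
  ultimately show ?thesis
    using main N unfolding Q_def B_def by linarith
qed

end

section \<open>Measurability of sampled gradients\<close>

text \<open>
  The function is the pointwise limit of the functions that first round \<open>y\<close> to the lower corner of its
  cell in the grid of mesh \<open>1 / (m + 1)\<close>.  There are countably many cells, so these are measurable.
\<close>

lemma caratheodory_measurable:
  fixes f :: "real ^ 'n \<Rightarrow> 's \<Rightarrow> real"
  assumes meas: "\<And>y. f y \<in> borel_measurable D"
    and cont: "\<And>s. s \<in> space D \<Longrightarrow> continuous_on UNIV (\<lambda>y. f y s)"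
  shows "(\<lambda>p. f (fst p) (snd p)) \<in> borel_measurable (borel \<Otimes>\<^sub>M D)"
proof -
  define cell :: "nat \<Rightarrow> real ^ 'n \<Rightarrow> int ^ 'n" where
    "cell m y = (\<chi> i. \<lfloor>real (Suc m) * y $ i\<rfloor>)" for m y
  define corner :: "nat \<Rightarrow> int ^ 'n \<Rightarrow> real ^ 'n" where
    "corner m a = (\<chi> i. real_of_int (a $ i) / real (Suc m))" for m a
  have cell: "cell m \<in> measurable borel (count_space UNIV)" for m
    unfolding measurable_count_space_eq2_countable
  proof (intro conjI ballI)
    fix a :: "int ^ 'n"
    have [measurable]: "(\<lambda>y :: real ^ 'n. y $ i) \<in> borel_measurable borel" for i
      by (rule borel_measurable_vec_component) simp
    have "cell m -` {a} \<inter> space borel = {y \<in> space borel. \<forall>i\<in>UNIV. \<lfloor>real (Suc m) * y $ i\<rfloor> = a $ i}"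
      by (auto simp: cell_def vec_eq_iff)
    also have "\<dots> \<in> sets borel"
      by (intro sets.sets_Collect_finite_All) (simp_all, measurable)
    finally show "cell m -` {a} \<inter> space borel \<in> sets borel" .
  qed simp
  have lim: "(\<lambda>m. corner m (cell m y)) \<longlonglongrightarrow> y" for y
  proof (rule vec_tendstoI)
    fix i
    show "(\<lambda>m. corner m (cell m y) $ i) \<longlonglongrightarrow> y $ i"
    proof (rule tendsto_sandwich)
      show "\<forall>\<^sub>F m in sequentially. y $ i - inverse (real (Suc m)) \<le> corner m (cell m y) $ i"
      proof (intro always_eventually allI)
        fix m
        have "real (Suc m) * y $ i - 1 \<le> real_of_int \<lfloor>real (Suc m) * y $ i\<rfloor>" by linarith
        then have "(real (Suc m) * y $ i - 1) / real (Suc m) \<le> real_of_int \<lfloor>real (Suc m) * y $ i\<rfloor> / real (Suc m)"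
          by (intro divide_right_mono) auto
        then show "y $ i - inverse (real (Suc m)) \<le> corner m (cell m y) $ i"
          by (simp add: corner_def cell_def diff_divide_distrib inverse_eq_divide del: of_nat_Suc)
      qed
      show "\<forall>\<^sub>F m in sequentially. corner m (cell m y) $ i \<le> y $ i"
      proof (intro always_eventually allI)
        fix m
        have "real_of_int \<lfloor>real (Suc m) * y $ i\<rfloor> / real (Suc m) \<le> (real (Suc m) * y $ i) / real (Suc m)"
          by (intro divide_right_mono of_int_floor_le) auto
        then show "corner m (cell m y) $ i \<le> y $ i"
          by (simp add: corner_def cell_def del: of_nat_Suc)
      qed
      show "(\<lambda>m. y $ i - inverse (real (Suc m))) \<longlonglongrightarrow> y $ i"
        using tendsto_diff[OF tendsto_const LIMSEQ_inverse_real_of_nat, of "y $ i"] by simp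
    qed simp
  qed
  show ?thesis
  proof (rule borel_measurable_LIMSEQ_real)
    fix m
    show "(\<lambda>p. f (corner m (cell m (fst p))) (snd p)) \<in> borel_measurable (borel \<Otimes>\<^sub>M D)"
    proof (rule measurable_compose_countable)
      show "(\<lambda>p. cell m (fst p)) \<in> borel \<Otimes>\<^sub>M D \<rightarrow>\<^sub>M count_space UNIV"
        using measurable_compose[OF measurable_fst cell] .
      show "(\<lambda>p. f (corner m a) (snd p)) \<in> borel_measurable (borel \<Otimes>\<^sub>M D)" for a
        using measurable_compose[OF measurable_snd meas] .
    qed
  next
    fix p :: "(real ^ 'n) \<times> 's" assume "p \<in> space ((borel :: (real ^ 'n) measure) \<Otimes>\<^sub>M D)"
    then have "snd p \<in> space D" by (auto simp: space_pair_measure)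
    then have "isCont (\<lambda>y. f y (snd p)) (fst p)"
      using cont by (simp add: continuous_on_eq_continuous_at)
    then show "(\<lambda>m. f (corner m (cell m (fst p))) (snd p)) \<longlonglongrightarrow> f (fst p) (snd p)"
      using lim by (rule isCont_tendsto_compose)
  qed
qed

text \<open>
  Each coordinate of the gradient is a limit of difference quotients.
\<close>

lemma grad_jointly_measurable:
  fixes f :: "real ^ 'n \<Rightarrow> 's \<Rightarrow> real"
  assumes meas: "\<And>y. f y \<in> borel_measurable D"
    and diff: "\<And>y s. s \<in> space D \<Longrightarrow> (\<lambda>z. f z s) differentiable (at y)"
  shows "(\<lambda>p. grad (\<lambda>z. f z (snd p)) (fst p)) \<in> borel_measurable (borel \<Otimes>\<^sub>M D)"
proof (rule borel_measurable_euclidean_space[THEN iffD2], rule ballI)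
  fix b :: "real ^ 'n" assume "b \<in> Basis"
  have f: "(\<lambda>p. f (fst p) (snd p)) \<in> borel_measurable (borel \<Otimes>\<^sub>M D)"
    using meas
  proof (rule caratheodory_measurable)
    show "continuous_on UNIV (\<lambda>y. f y s)" if "s \<in> space D" for s
      unfolding continuous_on_eq_continuous_at[OF open_UNIV]
      using diff[OF that] differentiable_imp_continuous_within by blast
  qed
  have shifted: "(\<lambda>p. f (fst p + c) (snd p)) \<in> borel_measurable (borel \<Otimes>\<^sub>M D)" for c
  proof -
    have "(\<lambda>p. (fst p + c, snd p)) \<in> borel \<Otimes>\<^sub>M D \<rightarrow>\<^sub>M borel \<Otimes>\<^sub>M D"
      by measurable
    from measurable_compose[OF this f] show ?thesis by simp
  qed
  show "(\<lambda>p. grad (\<lambda>z. f z (snd p)) (fst p) \<bullet> b) \<in> borel_measurable (borel \<Otimes>\<^sub>M D)"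
  proof (rule borel_measurable_LIMSEQ_real)
    fix m
    show "(\<lambda>p. (f (fst p + inverse (real (Suc m)) *\<^sub>R b) (snd p) - f (fst p) (snd p)) / inverse (real (Suc m)))
        \<in> borel_measurable (borel \<Otimes>\<^sub>M D)"
      by (intro borel_measurable_divide borel_measurable_diff shifted f borel_measurable_const)
  next
    fix p :: "(real ^ 'n) \<times> 's" assume "p \<in> space ((borel :: (real ^ 'n) measure) \<Otimes>\<^sub>M D)"
    then have "snd p \<in> space D" by (auto simp: space_pair_measure)
    then have "(\<lambda>z. f z (snd p)) differentiable (at (fst p + 0 *\<^sub>R b))"
      using diff by simp
    from differentiable_DERIV_along_line[OF this]
    have "((\<lambda>h. (f (fst p + h *\<^sub>R b) (snd p) - f (fst p) (snd p)) / h)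
        \<longlongrightarrow> b \<bullet> grad (\<lambda>z. f z (snd p)) (fst p)) (at 0)"
      by (simp add: has_field_derivative_iff)
    moreover have "filterlim (\<lambda>m. inverse (real (Suc m))) (at 0) sequentially"
      by (rule filterlim_atI[OF LIMSEQ_inverse_real_of_nat]) simp
    ultimately show "(\<lambda>m. (f (fst p + inverse (real (Suc m)) *\<^sub>R b) (snd p) - f (fst p) (snd p)) / inverse (real (Suc m)))
        \<longlonglongrightarrow> grad (\<lambda>z. f z (snd p)) (fst p) \<bullet> b"
      unfolding inner_commute[of _ b] by (rule filterlim_compose)
  qed
qed

section \<open>Algebras generated by independent samples\<close>

lemma space_sample_algebra [simp]: "space (sample_algebra M D \<xi> I) = space M"
  by (simp add: sample_algebra_def)

lemma sample_measurable:
  assumes \<xi>: "\<And>j. j \<in> I \<Longrightarrow> \<xi> j \<in> measurable M D" and j: "j \<in> I"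
  shows "\<xi> j \<in> measurable (sample_algebra M D \<xi> I) D"
proof -
  have "(\<lambda>\<omega>. \<lambda>j\<in>I. \<xi> j \<omega>) \<in> measurable (sample_algebra M D \<xi> I) (Pi\<^sub>M I (\<lambda>_. D))"
    unfolding sample_algebra_def using \<xi>
    by (intro measurable_vimage_algebra1) (auto simp: space_PiM intro: measurable_space)
  from measurable_compose[OF this measurable_component_singleton[OF j]] show ?thesis
    using j by simp
qed

lemma sample_algebra_least:
  assumes N: "space N = space M" and \<xi>: "\<And>j. j \<in> I \<Longrightarrow> \<xi> j \<in> measurable N D"
  shows "subalgebra N (sample_algebra M D \<xi> I)"
  unfolding subalgebra_def
proof
  show "sets (sample_algebra M D \<xi> I) \<subseteq> sets N"
    unfolding sample_algebra_def using N \<xi> by (intro sets_image_in_sets measurable_restrict) auto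
qed (simp add: N)

lemma (in prob_space) disjoint_sample_algebras_indep:
  assumes "indep_vars (\<lambda>_. D) \<xi> I" "A \<inter> B = {}" "A \<subseteq> I" "B \<subseteq> I"
  shows "indep_set (sets (sample_algebra M D \<xi> A)) (sets (sample_algebra M D \<xi> B))"
  using indep_var_restrict[OF assms] unfolding indep_var_eq
  by (simp add: sample_algebra_def sets_vimage_algebra)

text \<open>
  Fubini for independent random elements.  Independence is expressed through algebras so that
  \<open>X\<close> and \<open>Y\<close> may take values in different types.
\<close>

lemma (in prob_space) indep_algebras_nn_integral:
  assumes indep: "indep_set (sets A) (sets B)"
    and space: "space A = space M" "space B = space M"
    and X: "X \<in> measurable A S" and Y: "Y \<in> measurable B T"
    and \<phi>: "(\<lambda>p. \<phi> (fst p) (snd p)) \<in> borel_measurable (S \<Otimes>\<^sub>M T)"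
  shows "(\<integral>\<^sup>+\<omega>. \<phi> (X \<omega>) (Y \<omega>) \<partial>M) = (\<integral>\<^sup>+u. \<integral>\<^sup>+v. \<phi> u v \<partial>distr M T Y \<partial>distr M S X)"
proof -
  have sub: "subalgebra M A" "subalgebra M B"
    using indep_setD_ev1[OF indep] indep_setD_ev2[OF indep] space by (auto simp: subalgebra_def)
  have XM: "X \<in> measurable M S" by (rule measurable_from_subalg[OF sub(1) X])
  have YM: "Y \<in> measurable M T" by (rule measurable_from_subalg[OF sub(2) Y])
  interpret X: prob_space "distr M S X" using XM by (rule prob_space_distr)
  interpret Y: prob_space "distr M T Y" using YM by (rule prob_space_distr)
  have joint: "distr M S X \<Otimes>\<^sub>M distr M T Y = distr M (S \<Otimes>\<^sub>M T) (\<lambda>\<omega>. (X \<omega>, Y \<omega>))"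
  proof (rule pair_measure_eqI)
    fix C E assume "C \<in> sets (distr M S X)" "E \<in> sets (distr M T Y)"
    then have C: "C \<in> sets S" and E: "E \<in> sets T" by auto
    have "emeasure (distr M (S \<Otimes>\<^sub>M T) (\<lambda>\<omega>. (X \<omega>, Y \<omega>))) (C \<times> E)
        = emeasure M ((\<lambda>\<omega>. (X \<omega>, Y \<omega>)) -` (C \<times> E) \<inter> space M)"
      using XM YM C E by (intro emeasure_distr) auto
    also have "(\<lambda>\<omega>. (X \<omega>, Y \<omega>)) -` (C \<times> E) \<inter> space M = (X -` C \<inter> space M) \<inter> (Y -` E \<inter> space M)"
      by auto
    also have "emeasure M \<dots> = emeasure M (X -` C \<inter> space M) * emeasure M (Y -` E \<inter> space M)"
      using indep_setD[OF indep measurable_sets[OF X C] measurable_sets[OF Y E]]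
      by (simp add: space emeasure_eq_measure ennreal_mult')
    finally show "emeasure (distr M S X) C * emeasure (distr M T Y) E
        = emeasure (distr M (S \<Otimes>\<^sub>M T) (\<lambda>\<omega>. (X \<omega>, Y \<omega>))) (C \<times> E)"
      using XM YM C E by (simp add: emeasure_distr)
  qed (unfold_locales, simp)
  have "(\<integral>\<^sup>+\<omega>. \<phi> (X \<omega>) (Y \<omega>) \<partial>M) = (\<integral>\<^sup>+p. \<phi> (fst p) (snd p) \<partial>distr M (S \<Otimes>\<^sub>M T) (\<lambda>\<omega>. (X \<omega>, Y \<omega>)))"
    using XM YM \<phi> by (subst nn_integral_distr) auto
  also have "\<dots> = (\<integral>\<^sup>+u. \<integral>\<^sup>+v. \<phi> u v \<partial>distr M T Y \<partial>distr M S X)"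
    unfolding joint[symmetric]
    by (subst Y.nn_integral_fst[symmetric]) (use \<phi> in \<open>auto cong: measurable_cong_sets\<close>)
  finally show ?thesis .
qed

section \<open>Fresh samples and random iterates\<close>

lemma delayed_grad_measurable:
  fixes f :: "real ^ 'n \<Rightarrow> 's \<Rightarrow> real"
  assumes joint: "(\<lambda>p. grad (\<lambda>z. f z (snd p)) (fst p)) \<in> borel_measurable (borel \<Otimes>\<^sub>M D)"
    and x: "x (k - delay k) \<in> borel_measurable N" and \<xi>: "\<xi> k \<in> measurable N D"
  shows "(\<lambda>\<omega>. delayed_grad f (\<lambda>k. \<xi> k \<omega>) delay (\<lambda>k. x k \<omega>) k) \<in> borel_measurable N"
  using measurable_compose[OF measurable_Pair[OF x \<xi>] joint] by (simp add: delayed_grad_def)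

lemma iterates_adapted:
  fixes f :: "real ^ 'n \<Rightarrow> 's \<Rightarrow> real"
  assumes joint: "(\<lambda>p. grad (\<lambda>z. f z (snd p)) (fst p)) \<in> borel_measurable (borel \<Otimes>\<^sub>M D)"
    and \<xi>: "\<And>j. j \<ge> 1 \<Longrightarrow> \<xi> j \<in> measurable M D"
    and run: "\<And>\<omega>. \<omega> \<in> space M \<Longrightarrow> inertial_run f (\<lambda>k. \<xi> k \<omega>) delay step \<beta> x0 (\<lambda>k. x k \<omega>)"
  shows "x k \<in> borel_measurable (sample_algebra M D \<xi> {1..<k})"
proof (induction k rule: less_induct)
  case (less k)
  let ?N = "sample_algebra M D \<xi> {1..<k}"
  have cong: "x k \<in> borel_measurable ?N" if "Y \<in> borel_measurable ?N" "\<And>\<omega>. \<omega> \<in> space M \<Longrightarrow> x k \<omega> = Y \<omega>" for Y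
    using that measurable_cong[of ?N "x k" Y borel] by simp
  have earlier: "x m \<in> borel_measurable ?N" if "m < k" for m
  proof (rule measurable_from_subalg)
    show "subalgebra ?N (sample_algebra M D \<xi> {1..<m})"
      using that \<xi> by (intro sample_algebra_least sample_measurable) auto
  qed (rule less[OF that])
  consider "k = 0" | "k = 1" | m where "k = Suc m" "m \<ge> 1"
    by (cases k) (auto simp: Suc_le_eq)
  then show ?case
  proof cases
    case 1
    with run show ?thesis by (intro cong[of "\<lambda>_. x0"]) (auto simp: inertial_run_def)
  next
    case 2
    with run show ?thesis by (intro cong[of "\<lambda>_. x0"]) (auto simp: inertial_run_def)
  next
    case (3 m)
    let ?Y = "\<lambda>\<omega>. x m \<omega> - step m *\<^sub>R delayed_grad f (\<lambda>k. \<xi> k \<omega>) delay (\<lambda>k. x k \<omega>) m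
      + (step m / step (m - 1) * \<beta>) *\<^sub>R (x m \<omega> - x (m - 1) \<omega>)"
    have [measurable]: "x m \<in> borel_measurable ?N" "x (m - 1) \<in> borel_measurable ?N"
      by (rule earlier, simp add: 3(1))+
    have "\<xi> m \<in> measurable ?N D"
      using 3 by (intro sample_measurable) (auto intro: \<xi>)
    then have [measurable]: "(\<lambda>\<omega>. delayed_grad f (\<lambda>k. \<xi> k \<omega>) delay (\<lambda>k. x k \<omega>) m) \<in> borel_measurable ?N"
      by (intro delayed_grad_measurable[OF joint] earlier) (simp add: 3(1))
    show ?thesis
    proof (rule cong)
      show "?Y \<in> borel_measurable ?N" by measurable
      show "x k \<omega> = ?Y \<omega>" if "\<omega> \<in> space M" for \<omega>
        using run[OF that] 3 by (simp add: inertial_run_def)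
    qed
  qed
qed

text \<open>
  Conditionally on \<open>Y\<close>, the sample still has law \<open>D\<close>, so the bound at the fixed point \<open>y = Y \<omega>\<close> applies.
\<close>

lemma (in prob_space) fresh_sample_variance:
  fixes f :: "real ^ 'n \<Rightarrow> 's \<Rightarrow> real" and Y :: "'a \<Rightarrow> real ^ 'n"
  assumes joint: "(\<lambda>p. grad (\<lambda>z. f z (snd p)) (fst p)) \<in> borel_measurable (borel \<Otimes>\<^sub>M D)"
    and grad_F: "grad F \<in> borel_measurable borel"
    and indep: "indep_set (sets A) (sets B)" "space A = space M" "space B = space M"
    and Y: "Y \<in> borel_measurable A" and Z: "Z \<in> measurable B D" "distr M D Z = D"
    and variance: "\<And>y. (\<integral>\<^sup>+ s. ennreal ((norm (grad (\<lambda>z. f z s) y - grad F y))\<^sup>2) \<partial>D) \<le> v"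
  shows "(\<integral>\<^sup>+\<omega>. ennreal ((norm (grad (\<lambda>z. f z (Z \<omega>)) (Y \<omega>) - grad F (Y \<omega>)))\<^sup>2) \<partial>M) \<le> v"
proof -
  note [measurable] = joint grad_F
  have "(\<integral>\<^sup>+\<omega>. ennreal ((norm (grad (\<lambda>z. f z (Z \<omega>)) (Y \<omega>) - grad F (Y \<omega>)))\<^sup>2) \<partial>M)
      = (\<integral>\<^sup>+y. \<integral>\<^sup>+s. ennreal ((norm (grad (\<lambda>z. f z s) y - grad F y))\<^sup>2) \<partial>D \<partial>distr M borel Y)"
    using indep_algebras_nn_integral[OF indep Y Z(1),
        where \<phi> = "\<lambda>y s. ennreal ((norm (grad (\<lambda>z. f z s) y - grad F y))\<^sup>2)"]
    by (simp add: Z(2))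
  also have "\<dots> \<le> (\<integral>\<^sup>+y. v \<partial>distr M borel Y)"
    using variance by (intro nn_integral_mono)
  also have "\<dots> = v"
  proof -
    have "Y \<in> borel_measurable M"
      using indep_setD_ev1[OF indep(1)] indep(2) Y measurable_from_subalg[of M A]
      by (auto simp: subalgebra_def)
    from prob_space.emeasure_space_1[OF prob_space_distr[OF this]] show ?thesis by simp
  qed
  finally show ?thesis .
qed

text \<open>
  Splitting according to the value of \<open>J\<close>, which is independent of the process \<open>Z\<close>.
\<close>

lemma (in prob_space) nn_integral_random_index:
  assumes I: "finite I"
    and indep: "indep_set (sets A) (sets B)" "space A = space M" "space B = space M"
    and J: "J \<in> measurable A (count_space UNIV)"
    and Z: "\<And>k. k \<in> I \<Longrightarrow> Z k \<in> measurable B N"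
    and total: "(\<Sum>k\<in>I. prob {\<omega> \<in> space M. J \<omega> = k}) = 1"
    and h: "h \<in> borel_measurable N"
  shows "(\<integral>\<^sup>+\<omega>. h (Z (J \<omega>) \<omega>) \<partial>M)
    = (\<Sum>k\<in>I. ennreal (prob {\<omega> \<in> space M. J \<omega> = k}) * (\<integral>\<^sup>+\<omega>. h (Z k \<omega>) \<partial>M))"
proof -
  have sub: "subalgebra M A" "subalgebra M B"
    using indep_setD_ev1[OF indep(1)] indep_setD_ev2[OF indep(1)] indep(2,3)
    by (auto simp: subalgebra_def)
  have ZM [measurable]: "Z k \<in> measurable M N" if "k \<in> I" for k
    using measurable_from_subalg[OF sub(2) Z[OF that]] .
  have JM [measurable]: "J \<in> measurable M (count_space UNIV)"
    using measurable_from_subalg[OF sub(1) J] .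
  note [measurable] = h
  have "prob {\<omega> \<in> space M. J \<omega> \<in> I} = prob (\<Union>k\<in>I. {\<omega> \<in> space M. J \<omega> = k})"
    by (rule arg_cong[where f = prob]) auto
  also have "\<dots> = 1"
    unfolding total[symmetric] using I
    by (intro finite_measure_finite_Union) (auto simp: disjoint_family_on_def)
  finally have "AE \<omega> in M. J \<omega> \<in> I"
    using measurable_sets[OF JM, of I] by (subst (asm) prob_Collect_eq_1) (auto simp: vimage_def Int_def conj_commute)
  then have "(\<integral>\<^sup>+\<omega>. h (Z (J \<omega>) \<omega>) \<partial>M) = (\<integral>\<^sup>+\<omega>. (\<Sum>k\<in>I. indicator {k} (J \<omega>) * h (Z k \<omega>)) \<partial>M)"
  proof (intro nn_integral_cong_AE, elim eventually_mono)
    fix \<omega> assume "J \<omega> \<in> I"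
    have "(\<Sum>k\<in>I. indicator {k} (J \<omega>) * h (Z k \<omega>)) = (\<Sum>k\<in>I. if k = J \<omega> then h (Z k \<omega>) else 0)"
      by (intro sum.cong) (auto simp: indicator_def)
    then show "h (Z (J \<omega>) \<omega>) = (\<Sum>k\<in>I. indicator {k} (J \<omega>) * h (Z k \<omega>))"
      using I \<open>J \<omega> \<in> I\<close> by simp
  qed
  also have "\<dots> = (\<Sum>k\<in>I. \<integral>\<^sup>+\<omega>. indicator {k} (J \<omega>) * h (Z k \<omega>) \<partial>M)"
    by (rule nn_integral_sum) (intro borel_measurable_times_ennreal measurable_compose[OF JM]
        measurable_compose[OF ZM h] borel_measurable_count_space)
  also have "\<dots> = (\<Sum>k\<in>I. ennreal (prob {\<omega> \<in> space M. J \<omega> = k}) * (\<integral>\<^sup>+\<omega>. h (Z k \<omega>) \<partial>M))"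
  proof (rule sum.cong[OF refl])
    fix k assume k: "k \<in> I"
    have "(\<integral>\<^sup>+\<omega>. indicator {k} (J \<omega>) * h (Z k \<omega>) \<partial>M)
        = (\<integral>\<^sup>+j. \<integral>\<^sup>+z. indicator {k} j * h z \<partial>distr M N (Z k) \<partial>distr M (count_space UNIV) J)"
      by (rule indep_algebras_nn_integral[OF indep J Z[OF k]])
        (intro borel_measurable_times_ennreal measurable_compose[OF measurable_fst]
          measurable_compose[OF measurable_snd h] borel_measurable_count_space)
    also have "\<dots> = (\<integral>\<^sup>+j. (\<integral>\<^sup>+\<omega>. h (Z k \<omega>) \<partial>M) * indicator {k} j \<partial>distr M (count_space UNIV) J)"
    proof (rule nn_integral_cong)
      fix j
      have h': "h \<in> borel_measurable (distr M N (Z k))" using h by simp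
      then show "(\<integral>\<^sup>+z. indicator {k} j * h z \<partial>distr M N (Z k)) = (\<integral>\<^sup>+\<omega>. h (Z k \<omega>) \<partial>M) * indicator {k} j"
        by (subst nn_integral_cmult[OF h'])
          (simp only: nn_integral_distr[OF ZM[OF k] h'] mult.commute)
    qed
    also have "\<dots> = (\<integral>\<^sup>+\<omega>. h (Z k \<omega>) \<partial>M) * emeasure (distr M (count_space UNIV) J) {k}"
      by (rule nn_integral_cmult_indicator) simp
    also have "emeasure (distr M (count_space UNIV) J) {k} = emeasure M {\<omega> \<in> space M. J \<omega> = k}"
      by (subst emeasure_distr) (auto intro!: arg_cong[where f = "emeasure M"])
    finally show "(\<integral>\<^sup>+\<omega>. indicator {k} (J \<omega>) * h (Z k \<omega>) \<partial>M)
        = ennreal (prob {\<omega> \<in> space M. J \<omega> = k}) * (\<integral>\<^sup>+\<omega>. h (Z k \<omega>) \<partial>M)"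
      by (simp add: emeasure_eq_measure mult.commute)
  qed
  finally show ?thesis .
qed

theorem corollary5p5:
  fixes M :: "'w measure" and D :: "'s measure"
    and f :: "real ^ 'n \<Rightarrow> 's \<Rightarrow> real" and F :: "real ^ 'n \<Rightarrow> real"
    and \<xi> :: "nat \<Rightarrow> 'w \<Rightarrow> 's"
    and x0 :: "real ^ 'n" and x :: "nat \<Rightarrow> 'w \<Rightarrow> real ^ 'n" and g :: "nat \<Rightarrow> 'w \<Rightarrow> real ^ 'n"
    and delay :: "nat \<Rightarrow> nat" and \<tau> K :: nat
    and step :: "nat \<Rightarrow> real" and \<alpha> \<beta> \<rho> \<sigma> :: real
    and J :: "'w \<Rightarrow> nat" and xbar :: "'w \<Rightarrow> real ^ 'n"
  assumes "prob_space M" and "prob_space D"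
    and samples_distr: "\<And>k. k \<ge> 1 \<Longrightarrow> distr M D (\<xi> k) = D"
    and samples_fresh: "prob_space.indep_vars M (\<lambda>_. D) \<xi> {1..}"
    and f_integrable: "\<And>y. integrable D (f y)"
    and f_differentiable: "\<And>y s. s \<in> space D \<Longrightarrow> (\<lambda>z. f z s) differentiable (at y)"
    and F_def: "\<And>y. F y = (LINT s|D. f y s)"
    and \<rho>_pos: "\<rho> > 0"
    and F_smooth: "smooth_with \<rho> F"
    and \<beta>: "0 < \<beta>" "\<beta> < 1"
    and algorithm: "\<And>\<omega>. \<omega> \<in> space M \<Longrightarrow>
          inertial_run f (\<lambda>k. \<xi> k \<omega>) delay step \<beta> x0 (\<lambda>k. x k \<omega>)"
    and g_def: "\<And>k \<omega>. g k \<omega> = delayed_grad f (\<lambda>k. \<xi> k \<omega>) delay (\<lambda>k. x k \<omega>) k"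
    and unbiased: "\<And>k i. k \<ge> 1 \<Longrightarrow>
          AE \<omega> in M. real_cond_exp M (sample_algebra M D \<xi> {1..<k}) (\<lambda>\<omega>. g k \<omega> $ i) \<omega>
                     = grad F (x (k - delay k) \<omega>) $ i"
    and \<sigma>_nonneg: "\<sigma> \<ge> 0"
    and variance: "\<And>y. (\<integral>\<^sup>+ s. ennreal ((norm (grad (\<lambda>z. f z s) y - grad F y))\<^sup>2) \<partial>D)
                          \<le> ennreal (\<sigma>\<^sup>2)"
    and delay_bounded: "\<And>k. k \<ge> 1 \<Longrightarrow> delay k \<le> \<tau>"
    and "K \<ge> 1" and "\<alpha> > 0"
    and step_size: "\<And>k. k \<in> {1..K} \<Longrightarrow> step k = \<alpha> / sqrt (real K)"
    and step_0: "step 0 = step 1"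
    and cond1: "(real \<tau>)\<^sup>2 + real \<tau> / (1 - \<beta>) + \<beta>\<^sup>2 / (1 - \<beta>\<^sup>2)
                  \<le> (1 - \<beta>)\<^sup>2 * real K / (2 * \<alpha>\<^sup>2 * \<rho>\<^sup>2)"
    and cond2: "3 * \<rho> + 2 * (1 + 5 * \<rho>) * \<beta>\<^sup>2 / ((1 - \<beta>) * (1 - \<beta>\<^sup>2))
                  \<le> (1 - \<beta>) * sqrt (real K) / (2 * \<alpha>)"
    and J_measurable: "J \<in> measurable M (count_space UNIV)"
    and J_independent: "prob_space.indep_set M
          (sets (vimage_algebra (space M) J (count_space UNIV)))
          (sets (sample_algebra M D \<xi> {1..}))"
    and J_distr: "\<And>k. k \<in> {1..K} \<Longrightarrow>
          measure M {\<omega> \<in> space M. J \<omega> = k} = step k / (\<Sum>j=1..K. step j)"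
    and xbar_def: "\<And>\<omega>. \<omega> \<in> space M \<Longrightarrow> xbar \<omega> = x (J \<omega>) \<omega>"
  shows "enn2ereal (\<integral>\<^sup>+ \<omega>. ennreal ((norm (grad F (xbar \<omega>)))\<^sup>2) \<partial>M)
     \<le> ereal ((\<rho>\<^sup>2 * \<alpha> * real \<tau> / (2 * (1 - \<beta>) * sqrt (real K))
                + (1 + 5 * \<rho>) * \<beta>\<^sup>2 / (2 * (1 - \<beta>\<^sup>2)) + \<rho>)
              * (4 * \<alpha> * \<sigma>\<^sup>2 / ((1 - \<beta>) * sqrt (real K))))
       + ereal (4 * (1 - \<beta>)) * (ereal (F x0) - (INF y. ereal (F y)))
           / ereal (\<alpha> * sqrt (real K))"
proof -
  interpret M: prob_space M by fact
  define a where "a = \<alpha> / sqrt (real K)"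
  define \<eta> where "\<eta> = a / (1 - \<beta>)"
  define past where "past k = sample_algebra M D \<xi> {1..<k}" for k
  have a: "0 < a" using \<open>K \<ge> 1\<close> \<open>\<alpha> > 0\<close> by (simp add: a_def)
  then have \<eta>: "0 < \<eta>" using \<beta> by (simp add: \<eta>_def)
  \<comment> \<open>The constant step \<open>a\<close> makes every momentum coefficient equal to \<open>\<beta>\<close>; the convention
    \<open>step 0 = step 1\<close> covers the first one.\<close>
  have stepa: "step k = a" if "k \<le> K" for k
    using that step_size[of k] step_size[of 1] step_0 \<open>K \<ge> 1\<close> by (cases "k = 0") (auto simp: a_def)
  have \<xi>: "\<xi> j \<in> measurable M D" if "j \<ge> 1" for j
    using samples_fresh that unfolding M.indep_vars_def by auto
  have joint: "(\<lambda>p. grad (\<lambda>z. f z (snd p)) (fst p)) \<in> borel_measurable (borel \<Otimes>\<^sub>M D)"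
    using f_differentiable borel_measurable_integrable[OF f_integrable] by (intro grad_jointly_measurable)
  have grad_F: "grad F \<in> borel_measurable borel"
    using F_smooth by (rule smooth_with_grad_measurable)
  have x_adapted: "x k \<in> borel_measurable (past k)" for k
    unfolding past_def using joint \<xi> algorithm by (rule iterates_adapted)
  have past_sub: "subalgebra M (past k)" for k
    unfolding past_def using \<xi> by (intro sample_algebra_least) auto
  have past_mono: "subalgebra (past k) (past j)" if "j \<le> k" for j k
    unfolding past_def using that \<xi> by (intro sample_algebra_least sample_measurable) auto
  have x_past: "x (k - delay k) \<in> borel_measurable (past k)" for k
    using measurable_from_subalg[OF past_mono x_adapted] by simp

  interpret process: delayed_inertial_process M F past x g x0 delay \<tau> K \<eta> \<beta> \<rho> \<sigma>
  proof
    show "g k \<in> borel_measurable (past (Suc k))" if "k \<in> {1..K}" for k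
    proof -
      have "x (k - delay k) \<in> borel_measurable (past (Suc k))"
        using measurable_from_subalg[OF past_mono x_adapted] by simp
      moreover have "\<xi> k \<in> measurable (past (Suc k)) D"
        unfolding past_def using that \<xi> by (intro sample_measurable) auto
      ultimately show ?thesis
        unfolding g_def[abs_def] by (rule delayed_grad_measurable[OF joint])
    qed
    show "(\<integral>\<^sup>+\<omega>. ennreal ((norm (g k \<omega> - grad F (x (k - delay k) \<omega>)))\<^sup>2) \<partial>M) \<le> ennreal (\<sigma>\<^sup>2)"
      if k: "k \<in> {1..K}" for k
    proof -
      have "M.indep_set (sets (past k)) (sets (sample_algebra M D \<xi> {k}))"
        unfolding past_def using samples_fresh k by (intro M.disjoint_sample_algebras_indep) auto
      moreover have "\<xi> k \<in> measurable (sample_algebra M D \<xi> {k}) D"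
        using k \<xi> by (intro sample_measurable) auto
      ultimately have "(\<integral>\<^sup>+\<omega>. ennreal ((norm (grad (\<lambda>z. f z (\<xi> k \<omega>)) (x (k - delay k) \<omega>)
          - grad F (x (k - delay k) \<omega>)))\<^sup>2) \<partial>M) \<le> ennreal (\<sigma>\<^sup>2)"
        using x_past[of k] samples_distr[of k] variance k
        by (intro M.fresh_sample_variance[OF joint grad_F]) (auto simp: past_def)
      then show ?thesis by (simp add: g_def delayed_grad_def)
    qed
    show "x (Suc k) \<omega> = x k \<omega> - ((1 - \<beta>) * \<eta>) *\<^sub>R g k \<omega> + \<beta> *\<^sub>R (x k \<omega> - x (k - 1) \<omega>)"
      if "k \<in> {1..K}" "\<omega> \<in> space M" for k \<omega>
    proof -
      have "step k = a" "step (k - 1) = a" using that(1) by (auto intro!: stepa)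
      then show ?thesis
        using algorithm[OF that(2)] that(1) a \<beta> by (simp add: inertial_run_def g_def \<eta>_def)
    qed
    show "x 0 \<omega> = x0" "x 1 \<omega> = x0" if "\<omega> \<in> space M" for \<omega>
      using algorithm[OF that] by (auto simp: inertial_run_def)
    show "AE \<omega> in M. real_cond_exp M (past k) (\<lambda>\<omega>. g k \<omega> $ i) \<omega> = grad F (x (k - delay k) \<omega>) $ i"
      if "k \<in> {1..K}" for k i
      using unbiased[of k i] that by (simp add: past_def)
  qed (use F_smooth \<rho>_pos \<eta> \<beta> past_sub past_mono x_adapted delay_bounded in auto)

  define Q where "Q k = M.expectation (\<lambda>\<omega>. (norm (grad F (x k \<omega>)))\<^sup>2)" for k
  have Q: "(\<integral>\<^sup>+\<omega>. ennreal ((norm (grad F (x k \<omega>)))\<^sup>2) \<partial>M) = ennreal (Q k)" if "k \<in> {1..K}" for k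
    unfolding Q_def using that
    by (intro nn_integral_eq_integral square_integrable_integrable
        M.square_integrable_grad[OF F_smooth] process.x_square_integrable) auto
  have Q_nonneg: "0 \<le> Q k" for k by (simp add: Q_def)
  have prob_J: "measure M {\<omega> \<in> space M. J \<omega> = k} = 1 / real K" if "k \<in> {1..K}" for k
    using J_distr[OF that] stepa that a \<open>K \<ge> 1\<close> by simp
  have "(\<integral>\<^sup>+\<omega>. ennreal ((norm (grad F (xbar \<omega>)))\<^sup>2) \<partial>M)
      = (\<integral>\<^sup>+\<omega>. ennreal ((norm (grad F (x (J \<omega>) \<omega>)))\<^sup>2) \<partial>M)"
    by (intro nn_integral_cong) (simp add: xbar_def)
  also have "\<dots> = (\<Sum>k\<in>{1..K}. ennreal (measure M {\<omega> \<in> space M. J \<omega> = k}) *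
      (\<integral>\<^sup>+\<omega>. ennreal ((norm (grad F (x k \<omega>)))\<^sup>2) \<partial>M))"
  proof (rule M.nn_integral_random_index[where h = "\<lambda>y. ennreal ((norm (grad F y))\<^sup>2)" and N = borel,
        OF _ J_independent])
    show "(\<Sum>k\<in>{1..K}. measure M {\<omega> \<in> space M. J \<omega> = k}) = 1"
      using prob_J \<open>K \<ge> 1\<close> by simp
    show "x k \<in> borel_measurable (sample_algebra M D \<xi> {1..})" for k
    proof (rule measurable_from_subalg[OF _ x_adapted])
      show "subalgebra (sample_algebra M D \<xi> {1..}) (past k)"
        unfolding past_def using \<xi> by (intro sample_algebra_least sample_measurable) auto
    qed
    show "J \<in> vimage_algebra (space M) J (count_space UNIV) \<rightarrow>\<^sub>M count_space UNIV"
      by (rule measurable_vimage_algebra1) simp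
    show "(\<lambda>y. ennreal ((norm (grad F y))\<^sup>2)) \<in> borel_measurable borel"
      using grad_F by measurable
  qed simp_all
  also have "\<dots> = (\<Sum>k\<in>{1..K}. ennreal (1 / real K * Q k))"
    by (intro sum.cong refl) (simp only: Q prob_J ennreal_mult[OF _ Q_nonneg] divide_nonneg_nonneg
        zero_le_one of_nat_0_le_iff)
  also have "\<dots> = ennreal (1 / real K * (\<Sum>k\<in>{1..K}. Q k))"
    using Q_nonneg by (simp add: sum_distrib_left)
  finally have lhs: "enn2ereal (\<integral>\<^sup>+\<omega>. ennreal ((norm (grad F (xbar \<omega>)))\<^sup>2) \<partial>M)
      = ereal (1 / real K * (\<Sum>k\<in>{1..K}. Q k))"
    using Q_nonneg by (simp add: sum_nonneg)

  have INF_le: "(INF y. ereal (F y)) \<le> ereal (F y)" for y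
    by (rule INF_lower) simp
  show ?thesis
  proof (cases "INF y. ereal (F y)")
    \<comment> \<open>Impossible, since the infimum is at most \<open>F x0\<close>.\<close>
    case PInf
    then show ?thesis using INF_le[of x0] by simp
  next
    \<comment> \<open>The right-hand side is infinite.\<close>
    case MInf
    then show ?thesis using \<beta> \<open>\<alpha> > 0\<close> \<open>K \<ge> 1\<close> by simp
  next
    case (real c)
    have c: "c \<le> F y" for y using INF_le[of y] real by simp
    have sK: "0 < sqrt (real K)" using \<open>K \<ge> 1\<close> by simp
    have "1 / (2 * \<eta>\<^sup>2 * \<rho>\<^sup>2) = (1 - \<beta>)\<^sup>2 * real K / (2 * \<alpha>\<^sup>2 * \<rho>\<^sup>2)"
      by (simp add: \<eta>_def a_def power_divide power_mult_distrib mult_ac)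
    with cond1 have c1: "(real \<tau>)\<^sup>2 + real \<tau> / (1 - \<beta>) + \<beta>\<^sup>2 / (1 - \<beta>\<^sup>2) \<le> 1 / (2 * \<eta>\<^sup>2 * \<rho>\<^sup>2)"
      by simp
    have "1 / (2 * \<eta>) = (1 - \<beta>) * sqrt (real K) / (2 * \<alpha>)"
      using sK \<beta> \<open>\<alpha> > 0\<close> by (simp add: \<eta>_def a_def field_simps)
    with cond2 have c2: "3 * \<rho> + 2 * (1 + 5 * \<rho>) * \<beta>\<^sup>2 / ((1 - \<beta>) * (1 - \<beta>\<^sup>2)) \<le> 1 / (2 * \<eta>)"
      by simp
    define R where "R = \<rho>\<^sup>2 * \<eta> * real \<tau> / 2 + (1 + 5 * \<rho>) * (\<beta>\<^sup>2 / (1 - \<beta>\<^sup>2)) / 2 + \<rho>"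
    have sum_le: "\<eta> / 4 * (\<Sum>k\<in>{1..K}. Q k) \<le> F x0 - c + real K * (\<eta>\<^sup>2 * \<sigma>\<^sup>2 * R)"
      using process.gradient_sum_bound[OF c c1 c2] by (simp add: Q_def R_def)
    have noise: "4 / (\<eta> * real K) * (real K * (\<eta>\<^sup>2 * \<sigma>\<^sup>2 * R)) = R * (4 * \<eta> * \<sigma>\<^sup>2)"
      using \<eta> \<open>K \<ge> 1\<close> by (simp add: power2_eq_square[of \<eta>])
    have "1 / real K * (\<Sum>k\<in>{1..K}. Q k) = 4 / (\<eta> * real K) * (\<eta> / 4 * (\<Sum>k\<in>{1..K}. Q k))"
      using \<eta> by simp
    also have "\<dots> \<le> 4 / (\<eta> * real K) * (F x0 - c + real K * (\<eta>\<^sup>2 * \<sigma>\<^sup>2 * R))"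
      using \<eta> by (intro mult_left_mono sum_le) auto
    also have "\<dots> = R * (4 * \<eta> * \<sigma>\<^sup>2) + 4 / (\<eta> * real K) * (F x0 - c)"
      unfolding distrib_left[of "4 / (\<eta> * real K)"] noise by (rule add.commute)
    also have "4 / (\<eta> * real K) * (F x0 - c) = 4 * (1 - \<beta>) * (F x0 - c) / (\<alpha> * sqrt (real K))"
    proof -
      have "\<eta> * real K = \<alpha> * sqrt (real K) / (1 - \<beta>)"
        using arg_cong[OF real_div_sqrt[of "real K"], of "\<lambda>r. \<alpha> * r / (1 - \<beta>)"]
        by (simp add: \<eta>_def a_def mult_ac)
      then show ?thesis using \<beta> by simp
    qed
    also have "R * (4 * \<eta> * \<sigma>\<^sup>2) = (\<rho>\<^sup>2 * \<alpha> * real \<tau> / (2 * (1 - \<beta>) * sqrt (real K))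
        + (1 + 5 * \<rho>) * \<beta>\<^sup>2 / (2 * (1 - \<beta>\<^sup>2)) + \<rho>) * (4 * \<alpha> * \<sigma>\<^sup>2 / ((1 - \<beta>) * sqrt (real K)))"
      by (simp add: R_def \<eta>_def a_def mult_ac)
    finally show ?thesis
      unfolding lhs real using \<open>K \<ge> 1\<close> \<open>\<alpha> > 0\<close> by simp
  qed
qed

end
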